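(* Let $(X,K,\|\cdot\|)$ be an ordered Banach space whose norm is semimonotone, and let $T\colon[0,\infty)\to\mathcal{L}(X)$ be a $\mathrm{C}_0$-semigroup with generator $A$. If $A\colon X\supseteq\mathcal{D}(A)\to X$ is local and there exists $\lambda_0\in\rho(A)\cap\mathbb{R}$ such that for every (real) $\lambda\in\rho(A)$ with $\lambda\ge\lambda_0$ the operator $(\lambda I-A)^{-1}\colon X\to\mathcal{D}(A)\subseteq X$ is local, then $T(t)$ is local for every $t\in[0,\infty)$.
   Context: All vector spaces are real. A cone $K$ in $X$ is a subset with $\lambda x+\mu y\in K$ for all $x,y\in K$, $\lambda,\mu\ge 0$, and $K\cap(-K)=\{0\}$; it induces the partial order $x\le y:\Leftrightarrow y-x\in K$. $K$ is generating if $X=K-K$. An ordered Banach space $(X,K,\|\cdot\|)$ is a Banach space $(X,\|\cdot\|)$ with a closed generating cone $K$. The norm is semimonotone if there is a constant $M\in\mathbb{R}$ such that $0\le x\le y$ implies $\|x\|\le M\|y\|$. For $S\subseteq X$, $S^{\mathrm{u}}=\{x\in X: x\ge s\text{ for all }s\in S\}$ is the set of upper bounds. Elements $x,y\in X$ are disjoint, $x\perp y$, if $\{x+y,-x-y\}^{\mathrm{u}}=\{x-y,-x+y\}^{\mathrm{u}}$. $\mathcal{L}(X)$ denotes the bounded linear operators on $X$. A linear operator $S\colon X\supseteq\mathcal{D}(S)\to X$, defined on a linear subspace $\mathcal{D}(S)$, is local if for every $x\in\mathcal{D}(S)$ and $y\in X$ with $x\perp y$ one has $Sx\perp y$ (disjointness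 taken in $X$). $\rho(A)$ is the resolvent set of $A$: a real $\lambda$ belongs to $\rho(A)$ iff $\lambda I-A\colon\mathcal{D}(A)\to X$ is bijective with bounded inverse. *)

theory Defs
  imports "HOL-Analysis.Analysis"
begin

section \<open>Ordered Banach spaces\<close>

text \<open>
  The cone is an explicit set, since the order is not a type class instance. The predicate
  \<open>cone\<close> of the library only demands closure under nonnegative scaling; an \<open>order_cone\<close>
  is in addition convex and pointed. It is nonempty because of the last condition.
\<close>

definition order_cone :: "'a::real_vector set \<Rightarrow> bool" where
  "order_cone K \<longleftrightarrow>
     (\<forall>x\<in>K. \<forall>y\<in>K. \<forall>a b. 0 \<le> a \<longrightarrow> 0 \<le> b \<longrightarrow> a *\<^sub>R x + b *\<^sub>R y \<in> K) \<and>
     K \<inter> uminus ` K = {0}"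

definition cone_le :: "'a::real_vector set \<Rightarrow> 'a \<Rightarrow> 'a \<Rightarrow> bool" where
  "cone_le K x y \<longleftrightarrow> y - x \<in> K"

definition generating :: "'a::real_vector set \<Rightarrow> bool" where
  "generating K \<longleftrightarrow> UNIV = {x - y | x y. x \<in> K \<and> y \<in> K}"

definition ordered_banach_space :: "'a::banach set \<Rightarrow> bool" where
  "ordered_banach_space K \<longleftrightarrow> order_cone K \<and> closed K \<and> generating K"

definition semimonotone_norm :: "'a::real_normed_vector set \<Rightarrow> bool" where
  "semimonotone_norm K \<longleftrightarrow>
     (\<exists>M::real. \<forall>x y. cone_le K 0 x \<longrightarrow> cone_le K x y \<longrightarrow> norm x \<le> M * norm y)"

definition upper_bounds :: "'a::real_vector set \<Rightarrow> 'a set \<Rightarrow> 'a set" where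
  "upper_bounds K S = {x. \<forall>s\<in>S. cone_le K s x}"

definition disjoint_elems :: "'a::real_vector set \<Rightarrow> 'a \<Rightarrow> 'a \<Rightarrow> bool" where
  "disjoint_elems K x y \<longleftrightarrow>
     upper_bounds K {x + y, - x - y} = upper_bounds K {x - y, - x + y}"

section \<open>Operators\<close>

text \<open>
  An operator defined on a linear subspace \<open>D\<close> is represented by \<open>D\<close> together with a total
  function of which only the values on \<open>D\<close> are used. Linearity is not part of
  \<open>local_operator\<close>: a semigroup, its generator and its resolvents are linear anyway.
\<close>

definition local_operator :: "'a::real_vector set \<Rightarrow> 'a set \<Rightarrow> ('a \<Rightarrow> 'a) \<Rightarrow> bool" where
  "local_operator K D S \<longleftrightarrow>
     (\<forall>x\<in>D. \<forall>y. disjoint_elems K x y \<longrightarrow> disjoint_elems K (S x) y)"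

definition resolvent :: "'a::real_normed_vector set \<Rightarrow> ('a \<Rightarrow> 'a) \<Rightarrow> real \<Rightarrow> 'a \<Rightarrow> 'a" where
  "resolvent D A \<mu> = inv_into D (\<lambda>x. \<mu> *\<^sub>R x - A x)"

text \<open>The real part \<open>\<rho>(A) \<inter> \<real>\<close> of the resolvent set.\<close>

definition real_resolvent_set :: "'a::real_normed_vector set \<Rightarrow> ('a \<Rightarrow> 'a) \<Rightarrow> real set" where
  "real_resolvent_set D A =
     {\<mu>. bij_betw (\<lambda>x. \<mu> *\<^sub>R x - A x) D UNIV \<and> bounded_linear (resolvent D A \<mu>)}"

section \<open>Strongly continuous semigroups\<close>

text \<open>The values of \<open>T\<close> at negative times are never used.\<close>

definition C0_semigroup :: "(real \<Rightarrow> ('a::banach \<Rightarrow>\<^sub>L 'a)) \<Rightarrow> bool" where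
  "C0_semigroup T \<longleftrightarrow>
     T 0 = id_blinfun \<and>
     (\<forall>s\<ge>0. \<forall>t\<ge>0. T (s + t) = T s o\<^sub>L T t) \<and>
     (\<forall>x. ((\<lambda>t. blinfun_apply (T t) x) \<longlongrightarrow> x) (at_right 0))"

definition generator_domain :: "(real \<Rightarrow> ('a::banach \<Rightarrow>\<^sub>L 'a)) \<Rightarrow> 'a set" where
  "generator_domain T =
     {x. \<exists>y. ((\<lambda>h. (1 / h) *\<^sub>R (blinfun_apply (T h) x - x)) \<longlongrightarrow> y) (at_right 0)}"

definition generator :: "(real \<Rightarrow> ('a::banach \<Rightarrow>\<^sub>L 'a)) \<Rightarrow> 'a \<Rightarrow> 'a" where
  "generator T x = Lim (at_right 0) (\<lambda>h. (1 / h) *\<^sub>R (blinfun_apply (T h) x - x))"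

end

theory Submission
  imports Defs
begin

text \<open>
  The set of all \<open>x\<close> disjoint from a given \<open>y\<close> is closed and stable under multiplication by
  positive scalars. Closedness rests on Ando's theorem that in a Banach space with closed
  generating cone every \<open>x\<close> lies between \<open>- v\<close> and \<open>v\<close> for some \<open>v\<close> with
  \<open>norm v \<le> C * norm x\<close>, where \<open>C\<close> does not depend on \<open>x\<close>. Locality of the
  resolvents and the scaling property make the set invariant under the implicit Euler steps
  \<open>\<mu> (\<mu> - A)\<^sup>-\<^sup>1\<close> for all large \<open>\<mu>\<close>, and the exponential formula
  \<open>T(t) x = lim ((n/t) (n/t - A)\<^sup>-\<^sup>1)\<^sup>n x\<close> transfers the invariance to \<open>T(t)\<close>.
\<close>

section \<open>Disjointness in ordered Banach spaces\<close>

text \<open>For the set of elements disjoint from \<open>y\<close>, only closedness and stability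
  under positive scalars are established here, not additivity. The exponential formula suits this:
  it consists of compositions of resolvents with positive factors, whereas the exponential series of
  a Yosida approximation would force sums. Disjointness compares sets of upper bounds, so a small
  perturbation of \<open>x\<close> must be answered by an upper bound that is small in norm; a bare
  decomposition into cone elements gives no such control, hence Ando's theorem. On the analytic
  side, the growth constant of the semigroup could pile up over the \<open>n\<close> Euler steps; an
  equivalent norm in which this constant is 1 prevents that.\<close>

text \<open>Serves both the majorants and the semigroup near time 0. A point \<open>z\<close> near 0
  is the midpoint of \<open>x + z\<close> and \<open>- (x - z)\<close>, so symmetry and convexity
  move a ball around an interior point \<open>x\<close> to the origin.\<close>

lemma Baire_closed_convex_symmetric:
  fixes F :: "nat \<Rightarrow> 'a::banach set"
  assumes closed: "\<And>n. closed (F n)"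
    and convex: "\<And>n. convex (F n)"
    and symmetric: "\<And>n x. x \<in> F n \<Longrightarrow> - x \<in> F n"
    and cover: "(\<Union>n. F n) = UNIV"
  obtains n r where "0 < r" "ball 0 r \<subseteq> F n"
proof -
  have "\<exists>n. interior (F n) \<noteq> {}"
  proof (rule ccontr)
    assume "\<nexists>n. interior (F n) \<noteq> {}"
    then have "euclidean interior_of \<Union>(range F) = {}"
      by (intro Baire_category_alt)
         (auto simp: completely_metrizable_space_euclidean closed)
    then show False
      using cover by simp
  qed
  then obtain n x where "x \<in> interior (F n)"
    by blast
  then obtain r where r: "0 < r" "ball x r \<subseteq> F n"
    using mem_interior by blast
  have "ball 0 r \<subseteq> F n"
  proof
    fix z :: 'a
    assume "z \<in> ball 0 r"
    then have "x + z \<in> ball x r" "x - z \<in> ball x r"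
      by (simp_all add: dist_norm)
    then have "x + z \<in> F n" "- (x - z) \<in> F n"
      using r(2) symmetric by blast+
    then have "(1 / 2) *\<^sub>R (x + z) + (1 / 2) *\<^sub>R (- (x - z)) \<in> F n"
      by (intro convexD[OF convex]) auto
    moreover have "(1 / 2) *\<^sub>R (x + z) + (1 / 2) *\<^sub>R (- (x - z)) = z"
      by (simp add: algebra_simps flip: scaleR_2)
    ultimately show "z \<in> F n"
      by simp
  qed
  with r(1) show thesis
    by (rule that)
qed

section \<open>Majorants and the scaling of disjoint elements\<close>

text \<open>In a vector lattice these are the elements above the modulus of \<open>x\<close>, so
  disjointness generalises the equality of the moduli of \<open>x + y\<close> and
  \<open>x - y\<close>.\<close>

definition majorants :: "'a::real_vector set \<Rightarrow> 'a \<Rightarrow> 'a set" where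
  "majorants K x = {w. w - x \<in> K \<and> w + x \<in> K}"

lemma disjoint_elems_iff_majorants:
  "disjoint_elems K x y \<longleftrightarrow> majorants K (x + y) = majorants K (x - y)"
proof -
  have "upper_bounds K {x + y, - x - y} = majorants K (x + y)"
    by (auto simp: upper_bounds_def majorants_def cone_le_def algebra_simps)
  moreover have "upper_bounds K {x - y, - x + y} = majorants K (x - y)"
    by (auto simp: upper_bounds_def majorants_def cone_le_def algebra_simps)
  ultimately show ?thesis
    by (simp add: disjoint_elems_def)
qed

lemma majorants_minus: "majorants K (- x) = majorants K x"
  by (auto simp: majorants_def)

lemma disjoint_elems_sym: "disjoint_elems K x y \<Longrightarrow> disjoint_elems K y x"
  using majorants_minus[of K "x - y"] by (simp add: disjoint_elems_iff_majorants add.commute)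

lemma disjoint_elems_uminus: "disjoint_elems K x y \<Longrightarrow> disjoint_elems K x (- y)"
  by (simp add: disjoint_elems_iff_majorants)

locale banach_cone =
  fixes K :: "'a::banach set"
  assumes ordered_banach_space: "ordered_banach_space K"
begin

lemma closed_cone: "closed K"
  using ordered_banach_space by (simp add: ordered_banach_space_def)

lemma cone_comb: "x \<in> K \<Longrightarrow> y \<in> K \<Longrightarrow> 0 \<le> a \<Longrightarrow> 0 \<le> b \<Longrightarrow> a *\<^sub>R x + b *\<^sub>R y \<in> K"
  using ordered_banach_space by (auto simp: ordered_banach_space_def order_cone_def)

lemma zero_in_cone: "0 \<in> K"
  using ordered_banach_space by (auto simp: ordered_banach_space_def order_cone_def)

lemma cone_add: "x \<in> K \<Longrightarrow> y \<in> K \<Longrightarrow> x + y \<in> K"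
  using cone_comb[of x y 1 1] by simp

lemma cone_scaleR: "x \<in> K \<Longrightarrow> 0 \<le> a \<Longrightarrow> a *\<^sub>R x \<in> K"
  using cone_comb[of x x a 0] by simp

lemma majorants_add:
  assumes "v \<in> majorants K x" "w \<in> majorants K y"
  shows "v + w \<in> majorants K (x + y)"
proof -
  have "(v - x) + (w - y) \<in> K" "(v + x) + (w + y) \<in> K"
    using assms by (auto simp: majorants_def intro: cone_add)
  then show ?thesis
    by (simp add: majorants_def algebra_simps)
qed

lemma majorants_scaleR:
  assumes "v \<in> majorants K x"
  shows "\<bar>a\<bar> *\<^sub>R v \<in> majorants K (a *\<^sub>R x)"
proof -
  have "\<bar>a\<bar> *\<^sub>R (v - x) \<in> K" "\<bar>a\<bar> *\<^sub>R (v + x) \<in> K"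
    using assms by (auto simp: majorants_def intro: cone_scaleR)
  then show ?thesis
    by (cases "0 \<le> a") (simp_all add: majorants_def algebra_simps)
qed

lemma majorants_limit:
  assumes "v \<longlonglongrightarrow> w" "x \<longlonglongrightarrow> y" "\<And>n. v n \<in> majorants K (x n)"
  shows "w \<in> majorants K y"
proof -
  have "w - y \<in> K"
    by (rule closed_sequentially[OF closed_cone, of "\<lambda>n. v n - x n"])
       (use assms in \<open>auto simp: majorants_def intro: tendsto_diff\<close>)
  moreover have "w + y \<in> K"
    by (rule closed_sequentially[OF closed_cone, of "\<lambda>n. v n + x n"])
       (use assms in \<open>auto simp: majorants_def intro: tendsto_add\<close>)
  ultimately show ?thesis
    by (simp add: majorants_def)
qed

lemma ex_majorant: "\<exists>v. v \<in> majorants K x"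
proof -
  obtain a b where ab: "a \<in> K" "b \<in> K" "x = a - b"
    using ordered_banach_space unfolding ordered_banach_space_def generating_def by blast
  then have "2 *\<^sub>R b \<in> K" "2 *\<^sub>R a \<in> K"
    by (auto intro: cone_scaleR)
  then have "a + b \<in> majorants K x"
    by (simp add: majorants_def ab(3) scaleR_2 algebra_simps)
  then show ?thesis ..
qed

text \<open>
  Iterating \<open>v \<mapsto> p + c v\<close> inside the closed set of majorants of \<open>x\<close> leads to the fixed point
  \<open>p / (1 - c)\<close>.
\<close>

lemma majorants_affine_fixpoint:
  assumes c: "0 \<le> c" "c < 1"
    and p: "\<And>v. v \<in> majorants K x \<Longrightarrow> p + c *\<^sub>R v \<in> majorants K x"
  shows "p \<in> majorants K ((1 - c) *\<^sub>R x)"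
proof -
  obtain v where v: "v \<in> majorants K x"
    using ex_majorant by blast
  define q where "q = (1 / (1 - c)) *\<^sub>R p"
  have pq: "p = (1 - c) *\<^sub>R q"
    using c by (simp add: q_def)
  have "q + c ^ n *\<^sub>R (v - q) \<in> majorants K x" for n
  proof (induction n)
    case (Suc n)
    have "p + c *\<^sub>R (q + c ^ n *\<^sub>R (v - q)) = q + c ^ Suc n *\<^sub>R (v - q)"
      by (simp add: pq algebra_simps)
    then show ?case
      using p[OF Suc] by simp
  qed (simp add: v)
  moreover have "(\<lambda>n. q + c ^ n *\<^sub>R (v - q)) \<longlonglongrightarrow> q + 0 *\<^sub>R (v - q)"
    using c by (intro tendsto_intros LIMSEQ_power_zero) simp
  ultimately have "q \<in> majorants K x"
    using majorants_limit[of _ q "\<lambda>_. x" x] by simp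
  then show ?thesis
    using majorants_scaleR[of q x "1 - c"] c by (simp add: pq)
qed

text \<open>If \<open>v\<close> majorises \<open>x\<close>, then \<open>w + (1 - c) v\<close>
  majorises \<open>x + y\<close>, hence also \<open>x - y\<close>. The four resulting inequalities
  say that \<open>w - y + (1 - c) v\<close> and \<open>w + y + (1 - c) v\<close> again majorise
  \<open>x\<close>; the fixed point argument removes \<open>v\<close> and leaves
  \<open>w - y\<close> and \<open>w + y\<close> as majorants of \<open>c x\<close>.\<close>

lemma majorants_scaled_disjoint:
  assumes disj: "disjoint_elems K x y" and c: "0 < c" "c < 1"
    and w: "w \<in> majorants K (c *\<^sub>R x + y)"
  shows "w \<in> majorants K (c *\<^sub>R x - y)"
proof -
  have key: "w + (1 - c) *\<^sub>R v \<in> majorants K (x + y) \<inter> majorants K (x - y)"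
    if v: "v \<in> majorants K x" for v
  proof -
    have "w + (1 - c) *\<^sub>R v \<in> majorants K ((c *\<^sub>R x + y) + (1 - c) *\<^sub>R x)"
      using majorants_add[OF w majorants_scaleR[OF v, of "1 - c"]] c by simp
    moreover have "(c *\<^sub>R x + y) + (1 - c) *\<^sub>R x = x + y"
      by (simp add: algebra_simps)
    ultimately show ?thesis
      using disj by (simp add: disjoint_elems_iff_majorants)
  qed
  have "w - y \<in> majorants K ((1 - (1 - c)) *\<^sub>R x)"
    by (rule majorants_affine_fixpoint) (use c key in \<open>auto simp: majorants_def algebra_simps\<close>)
  moreover have "w + y \<in> majorants K ((1 - (1 - c)) *\<^sub>R x)"
    by (rule majorants_affine_fixpoint) (use c key in \<open>auto simp: majorants_def algebra_simps\<close>)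
  ultimately show ?thesis
    by (auto simp: majorants_def algebra_simps)
qed

lemma disjoint_elems_scaleR_lt_1:
  assumes "disjoint_elems K x y" "0 < c" "c < 1"
  shows "disjoint_elems K (c *\<^sub>R x) y"
  unfolding disjoint_elems_iff_majorants
proof (intro equalityI subsetI)
  fix w
  show "w \<in> majorants K (c *\<^sub>R x - y)" if "w \<in> majorants K (c *\<^sub>R x + y)"
    using majorants_scaled_disjoint[OF assms that] .
  show "w \<in> majorants K (c *\<^sub>R x + y)" if "w \<in> majorants K (c *\<^sub>R x - y)"
    using majorants_scaled_disjoint[OF disjoint_elems_uminus[OF assms(1)] assms(2,3), of w] that by simp
qed

lemma majorants_scaleR_iff:
  assumes "0 < c"
  shows "w \<in> majorants K (c *\<^sub>R x) \<longleftrightarrow> (1 / c) *\<^sub>R w \<in> majorants K x"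
proof
  show "(1 / c) *\<^sub>R w \<in> majorants K x" if "w \<in> majorants K (c *\<^sub>R x)"
    using majorants_scaleR[OF that, of "1 / c"] assms by simp
  show "w \<in> majorants K (c *\<^sub>R x)" if "(1 / c) *\<^sub>R w \<in> majorants K x"
    using majorants_scaleR[OF that, of c] assms by simp
qed

lemma disjoint_elems_scaleR_both:
  assumes "disjoint_elems K x y" "0 < c"
  shows "disjoint_elems K (c *\<^sub>R x) (c *\<^sub>R y)"
proof -
  have "majorants K (c *\<^sub>R (x + y)) = majorants K (c *\<^sub>R (x - y))"
    using assms(1) by (auto simp: majorants_scaleR_iff[OF assms(2)] disjoint_elems_iff_majorants)
  then show ?thesis
    by (simp add: disjoint_elems_iff_majorants scaleR_add_right scaleR_diff_right)
qed

text \<open>Disjointness is symmetric, so for \<open>c > 1\<close> one shrinks \<open>y\<close> by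
  \<open>1 / c\<close> and then multiplies both elements by \<open>c\<close>.\<close>

lemma disjoint_elems_scaleR:
  assumes "disjoint_elems K x y" "0 < c"
  shows "disjoint_elems K (c *\<^sub>R x) y"
proof (cases c "1 :: real" rule: linorder_cases)
  case less
  with assms show ?thesis
    by (intro disjoint_elems_scaleR_lt_1)
next
  case greater
  then have "disjoint_elems K ((1 / c) *\<^sub>R y) x"
    using assms by (intro disjoint_elems_scaleR_lt_1[OF disjoint_elems_sym]) auto
  from disjoint_elems_scaleR_both[OF disjoint_elems_sym[OF this] assms(2)] show ?thesis
    using assms by simp
qed (use assms in simp)

section \<open>Ando's theorem and closedness of disjoint complements\<close>

text \<open>The sets \<open>S n\<close> of elements with a majorant of norm at most \<open>n\<close>
  cover the space. They are not known to be closed, so Baire's theorem is applied to their closures;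
  this is where the error \<epsilon> comes from.\<close>

lemma approx_majorant:
  obtains C where "\<And>x \<epsilon>. 0 < \<epsilon> \<Longrightarrow>
    \<exists>z v. v \<in> majorants K z \<and> norm v \<le> C * norm x \<and> norm (x - z) < \<epsilon>"
proof -
  define S where "S n = {x. \<exists>v. v \<in> majorants K x \<and> norm v \<le> real n}" for n
  have convex: "convex (S n)" for n
  proof (rule convexI)
    fix x y :: 'a and a b :: real
    assume "x \<in> S n" "y \<in> S n" and ab: "0 \<le> a" "0 \<le> b" "a + b = 1"
    then obtain v w where "v \<in> majorants K x" "norm v \<le> real n" "w \<in> majorants K y" "norm w \<le> real n"
      by (auto simp: S_def)
    then have "a *\<^sub>R v + b *\<^sub>R w \<in> majorants K (a *\<^sub>R x + b *\<^sub>R y)"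
      "norm (a *\<^sub>R v + b *\<^sub>R w) \<le> a * real n + b * real n"
      using ab majorants_add[OF majorants_scaleR majorants_scaleR, of v x w y a b]
      by (auto intro!: norm_triangle_le add_mono mult_left_mono)
    then show "a *\<^sub>R x + b *\<^sub>R y \<in> S n"
      using ab by (auto simp: S_def simp flip: distrib_right)
  qed
  have symmetric: "- x \<in> closure (S n)" if "x \<in> closure (S n)" for n x
  proof -
    have "- y \<in> S n" if "y \<in> S n" for y
      using that by (simp add: S_def majorants_minus)
    then have "uminus ` S n = S n"
      by (metis image_subset_iff minus_minus subsetI subset_antisym image_eqI)
    then show ?thesis
      using closure_scaleR[of "- 1" "S n"] that by force
  qed
  have cover: "(\<Union>n. closure (S n)) = UNIV"
  proof (intro UNIV_eq_I[symmetric])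
    fix x
    obtain v where "v \<in> majorants K x"
      using ex_majorant by blast
    then have "x \<in> S (nat \<lceil>norm v\<rceil>)"
      by (auto simp: S_def intro!: exI[of _ v])
    then show "x \<in> (\<Union>n. closure (S n))"
      using closure_subset by blast
  qed
  obtain n r where r: "0 < r" "ball 0 r \<subseteq> closure (S n)"
    by (rule Baire_closed_convex_symmetric[of "\<lambda>n. closure (S n)"])
       (use convex symmetric cover convex_closure in auto)
  show thesis
  proof (rule that[of "2 * real n / r"])
    fix x :: 'a and \<epsilon> :: real
    assume \<epsilon>: "0 < \<epsilon>"
    show "\<exists>z v. v \<in> majorants K z \<and> norm v \<le> 2 * real n / r * norm x \<and> norm (x - z) < \<epsilon>"
    proof (cases "x = 0")
      case True
      then show ?thesis
        using \<epsilon> by (intro exI[of _ 0]) (auto simp: majorants_def zero_in_cone)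
    next
      case False
      \<comment> \<open>Scales \<open>x\<close> to norm \<open>r / 2\<close>, inside the open ball;
        undoing the scaling turns \<open>n\<close> into the constant \<open>2 n / r\<close>.\<close>
      define a where "a = r / (2 * norm x)"
      have a: "0 < a"
        using False r by (simp add: a_def)
      have "a *\<^sub>R x \<in> ball 0 r"
        using r False by (simp add: a_def)
      then obtain z where z: "z \<in> S n" "dist z (a *\<^sub>R x) < a * \<epsilon>"
        using r a \<epsilon> by (meson closure_approachable mult_pos_pos subsetD)
      then obtain v where v: "v \<in> majorants K z" "norm v \<le> real n"
        by (auto simp: S_def)
      have "norm (x - (1 / a) *\<^sub>R z) = norm ((1 / a) *\<^sub>R (a *\<^sub>R x - z))"
        using a by (simp add: algebra_simps)
      also have "\<dots> = (1 / a) * dist z (a *\<^sub>R x)"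
        using a by (simp add: dist_norm norm_minus_commute)
      also have "\<dots> < \<epsilon>"
        using a z(2) by (simp add: field_simps)
      finally have "norm (x - (1 / a) *\<^sub>R z) < \<epsilon>" .
      moreover have "(1 / a) *\<^sub>R v \<in> majorants K ((1 / a) *\<^sub>R z)"
        using majorants_scaleR[OF v(1), of "1 / a"] a by simp
      moreover have "norm ((1 / a) *\<^sub>R v) \<le> 2 * real n / r * norm x"
        using v(2) a r False by (simp add: a_def field_simps)
      ultimately show ?thesis
        by blast
    qed
  qed
qed

text \<open>
  Ando's theorem: successive approximation removes the error term of the previous lemma, as in
  the proof of the open mapping theorem.
\<close>

lemma bounded_majorant:
  obtains C where "\<And>x. \<exists>v. v \<in> majorants K x \<and> norm v \<le> C * norm x"
proof -
  obtain C where C: "\<And>x \<epsilon>. 0 < \<epsilon> \<Longrightarrow>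
    \<exists>z v. v \<in> majorants K z \<and> norm v \<le> C * norm x \<and> norm (x - z) < \<epsilon>"
    using approx_majorant by blast
  show thesis
  proof (rule that[of "2 * C"])
    fix x :: 'a
    show "\<exists>v. v \<in> majorants K x \<and> norm v \<le> 2 * C * norm x"
    proof (cases "x = 0")
      case True
      then show ?thesis
        by (intro exI[of _ 0]) (auto simp: majorants_def zero_in_cone)
    next
      case False
      define d where "d = norm x"
      have d: "0 < d"
        using False by (simp add: d_def)
      \<comment> \<open>Nothing was recorded about the sign of \<open>C\<close>; the bound at a
        nonzero \<open>x\<close> forces it to be nonnegative.\<close>
      obtain u :: 'a where "norm u \<le> C * norm x"
        using C[of 1 x] zero_less_one by blast
      then have "0 \<le> C * norm x"
        using norm_ge_zero order_trans by blast
      then have C0: "0 \<le> C"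
        using False by (simp add: zero_le_mult_iff)
      \<comment> \<open>The tolerance halves at each step, so the remainder \<open>y n\<close> has
        norm at most \<open>d / 2 ^ n\<close>. The geometric series bounding the majorants sums to
        \<open>2 * C * d\<close>, which explains the constant \<open>2 * C\<close>.\<close>
      have "\<forall>n. \<forall>y. \<exists>z v. v \<in> majorants K z \<and> norm v \<le> C * norm y \<and> norm (y - z) < d / 2 ^ Suc n"
        using C d by simp
      then obtain z v where zv: "\<And>n y. v n y \<in> majorants K (z n y)"
        "\<And>n y. norm (v n y) \<le> C * norm y" "\<And>n y. norm (y - z n y) < d / 2 ^ Suc n"
        by metis
      \<comment> \<open>What is left of \<open>x\<close> after \<open>n\<close>
        approximations.\<close>
      define y where "y = rec_nat x (\<lambda>n y. y - z n y)"
      have y0: "y 0 = x" and ySuc: "y (Suc n) = y n - z n (y n)" for n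
        by (simp_all add: y_def)
      have y: "norm (y n) \<le> d / 2 ^ n" for n
        by (cases n) (use zv(3) in \<open>auto simp: y0 ySuc d_def intro: less_imp_le\<close>)
      have v_le: "norm (v n (y n)) \<le> (C * d) * (1 / 2) ^ n" for n
        using order_trans[OF zv(2) mult_left_mono[OF y C0]] by (simp add: power_divide)
      have geom: "summable (\<lambda>n. (C * d) * (1 / 2) ^ n)"
        by (intro summable_mult summable_geometric) simp
      have v_summable: "summable (\<lambda>n. v n (y n))"
        using v_le by (intro summable_comparison_test'[OF geom]) auto
      have z_sum: "(\<Sum>i<n. z i (y i)) = x - y n" for n
        by (induction n) (simp_all add: y0 ySuc)
      have y_lim: "y \<longlonglongrightarrow> 0"
      proof (rule Lim_null_comparison)
        show "\<forall>\<^sub>F n in sequentially. norm (y n) \<le> d * (1 / 2) ^ n"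
          using y by (simp add: power_divide)
        show "(\<lambda>n. d * (1 / 2) ^ n) \<longlonglongrightarrow> 0"
          by (intro tendsto_mult_right_zero LIMSEQ_power_zero) simp
      qed
      have "(\<Sum>i<n. v i (y i)) \<in> majorants K (\<Sum>i<n. z i (y i))" for n
        by (induction n) (simp_all add: zv(1) majorants_add, simp add: majorants_def zero_in_cone)
      moreover have "(\<lambda>n. \<Sum>i<n. v i (y i)) \<longlonglongrightarrow> (\<Sum>n. v n (y n))"
        using v_summable by (rule summable_LIMSEQ)
      moreover have "(\<lambda>n. \<Sum>i<n. z i (y i)) \<longlonglongrightarrow> x"
        using tendsto_diff[OF tendsto_const[of x] y_lim] by (simp add: z_sum)
      ultimately have "(\<Sum>n. v n (y n)) \<in> majorants K x"
        using majorants_limit by blast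
      moreover have "norm (\<Sum>n. v n (y n)) \<le> (\<Sum>n. (C * d) * (1 / 2) ^ n)"
        using v_le by (intro norm_suminf_le geom)
      moreover have "(\<Sum>n. (C * d) * (1 / 2) ^ n) = 2 * C * norm x"
        by (subst suminf_mult) (simp_all add: suminf_geometric d_def)
      ultimately show ?thesis
        by auto
    qed
  qed
qed

text \<open>Passing from \<open>z\<close> to \<open>x n\<close> and back costs \<open>v n\<close>
  twice, where \<open>v n\<close> majorises \<open>x n - z\<close>. Ando's bound makes
  \<open>v n\<close> tend to 0, and closedness of the cone preserves the inequalities in the
  limit.\<close>

lemma disjoint_elems_limit:
  assumes lim: "x \<longlonglongrightarrow> z" and disj: "\<And>n. disjoint_elems K (x n) y"
  shows "disjoint_elems K z y"
proof -
  obtain C where "\<And>x. \<exists>v. v \<in> majorants K x \<and> norm v \<le> C * norm x"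
    using bounded_majorant by blast
  then have "\<forall>n. \<exists>v. v \<in> majorants K (x n - z) \<and> norm v \<le> C * norm (x n - z)"
    by blast
  then obtain v where v: "\<And>n. v n \<in> majorants K (x n - z)" "\<And>n. norm (v n) \<le> C * norm (x n - z)"
    by metis
  have "(\<lambda>n. C * norm (x n - z)) \<longlonglongrightarrow> 0"
    using lim by (intro tendsto_mult_right_zero) (simp add: LIM_zero tendsto_norm_zero)
  then have v_lim: "v \<longlonglongrightarrow> 0"
    using v(2) by (intro Lim_null_comparison[of v]) auto
  have v': "v n \<in> majorants K (z - x n)" for n
    using v(1)[of n] majorants_minus[of K "x n - z"] by simp
  have "w \<in> majorants K (z - u)"
    if w: "w \<in> majorants K (z + u)" and u: "\<And>n. disjoint_elems K (x n) u" for u w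
  proof (rule majorants_limit)
    fix n
    have "w + v n \<in> majorants K (x n + u)"
      using majorants_add[OF w v(1)[of n]] by (simp add: add.commute)
    then have "w + v n \<in> majorants K (x n - u)"
      using u by (simp add: disjoint_elems_iff_majorants)
    from majorants_add[OF this v'[of n]] show "w + v n + v n \<in> majorants K (z - u)"
      by simp
  next
    show "(\<lambda>n. w + v n + v n) \<longlonglongrightarrow> w"
      using v_lim by (auto intro!: tendsto_eq_intros)
  qed simp
  \<comment> \<open>The choices \<open>u = y\<close> and \<open>u = - y\<close> give the two
    inclusions.\<close>
  from this[OF _ disj] this[OF _ disjoint_elems_uminus[OF disj]] show ?thesis
    by (auto simp only: disjoint_elems_iff_majorants diff_minus_eq_add add_uminus_conv_diff)
qed

lemma closed_disjoint_complement: "closed {x. disjoint_elems K x y}"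
  using disjoint_elems_limit by (auto simp: closed_sequential_limits)

end

section \<open>Strongly continuous semigroups\<close>

locale strongly_continuous_semigroup =
  fixes T :: "real \<Rightarrow> ('a::banach \<Rightarrow>\<^sub>L 'a)"
  assumes C0_semigroup: "C0_semigroup T"
begin

abbreviation "D \<equiv> generator_domain T"
abbreviation "A \<equiv> generator T"

lemma T_0: "T 0 x = x"
  using C0_semigroup by (simp add: C0_semigroup_def)

lemma T_add: "0 \<le> s \<Longrightarrow> 0 \<le> t \<Longrightarrow> T (s + t) x = T s (T t x)"
  using C0_semigroup by (simp add: C0_semigroup_def)

lemma T_commute: "0 \<le> s \<Longrightarrow> 0 \<le> t \<Longrightarrow> T s (T t x) = T t (T s x)"
  using T_add[of s t x] T_add[of t s x] by (simp add: add.commute)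

lemma T_right_continuous_0: "((\<lambda>t. T t x) \<longlongrightarrow> x) (at_right 0)"
  using C0_semigroup by (simp add: C0_semigroup_def)

section \<open>Growth and continuity of orbits\<close>

text \<open>Right continuity bounds each orbit only on an interval that depends on \<open>x\<close>.
  Coupling the interval \<open>I n\<close> with the bound \<open>n\<close> gives a countable cover
  by closed convex symmetric sets, and a ball inside one of them yields a bound uniform in
  \<open>x\<close>.\<close>

lemma local_bound:
  obtains \<delta> C where "0 < \<delta>" "1 \<le> C" "\<And>t. 0 \<le> t \<Longrightarrow> t \<le> \<delta> \<Longrightarrow> norm (T t) \<le> C"
proof -
  define I where "I n = {0..inverse (real (Suc n))}" for n
  define F where "F n = (\<Inter>t\<in>I n. {x. norm (T t x) \<le> real n})" for n
  have "closed (F n)" for n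
    unfolding F_def by (intro closed_INT ballI closed_Collect_le continuous_intros)
  moreover have "convex (F n)" for n
  proof -
    have "convex {x. norm (T t x) \<le> real n}" for t
    proof (rule convexI)
      fix x y :: 'a and a b :: real
      assume xy: "x \<in> {x. norm (T t x) \<le> real n}" "y \<in> {x. norm (T t x) \<le> real n}"
        and ab: "0 \<le> a" "0 \<le> b" "a + b = 1"
      have "norm (T t (a *\<^sub>R x + b *\<^sub>R y)) \<le> a * norm (T t x) + b * norm (T t y)"
        using ab by (auto simp: blinfun.add_right blinfun.scaleR_right intro: norm_triangle_le)
      also have "\<dots> \<le> real n"
        using xy ab by (intro convex_bound_le) auto
      finally show "a *\<^sub>R x + b *\<^sub>R y \<in> {x. norm (T t x) \<le> real n}"
        by simp
    qed
    then show ?thesis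
      unfolding F_def by (intro convex_INT)
  qed
  moreover have "- x \<in> F n" if "x \<in> F n" for n x
    using that by (simp add: F_def blinfun.minus_right)
  moreover have "(\<Union>n. F n) = UNIV"
  proof (intro UNIV_eq_I[symmetric])
    fix x
    have "\<forall>\<^sub>F t in at_right 0. dist (T t x) x < 1"
      using T_right_continuous_0 by (rule tendstoD) simp
    then obtain b where b: "0 < b" "\<And>t. 0 < t \<Longrightarrow> t < b \<Longrightarrow> dist (T t x) x < 1"
      by (auto simp: eventually_at_right_field)
    obtain m where m: "inverse (real (Suc m)) < b"
      using reals_Archimedean[OF b(1)] by blast
    \<comment> \<open>Large for two reasons: \<open>I n\<close> must be shorter than
      \<open>b\<close>, and \<open>n\<close> must reach \<open>norm x + 1\<close>.\<close>
    define n where "n = max m (nat \<lceil>norm x + 1\<rceil>)"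
    have n: "norm x + 1 \<le> real n"
      by (simp add: n_def) linarith
    have "inverse (real (Suc n)) \<le> inverse (real (Suc m))"
      by (simp add: n_def)
    then have nb: "inverse (real (Suc n)) < b"
      using m by linarith
    have "norm (T t x) \<le> real n" if "t \<in> I n" for t
    proof (cases "t = 0")
      case True
      then show ?thesis
        using n by (simp add: T_0)
    next
      case False
      then have "dist (T t x) x < 1"
        using that nb by (intro b(2)) (auto simp: I_def)
      then have "norm (T t x) < norm x + 1"
        using norm_triangle_sub[of "T t x" x] by (simp add: dist_norm)
      then show ?thesis
        using n by simp
    qed
    then show "x \<in> (\<Union>n. F n)"
      by (auto simp: F_def)
  qed
  ultimately obtain n r where r: "0 < r" "ball 0 r \<subseteq> F n"
    by (rule Baire_closed_convex_symmetric)
  show thesis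
  proof (rule that[of "inverse (real (Suc n))" "max 1 (2 * real n / r)"])
    fix t :: real
    assume t: "0 \<le> t" "t \<le> inverse (real (Suc n))"
    have "norm (T t) \<le> 2 * real n / r"
    proof (rule norm_blinfun_bound)
      fix x
      show "norm (T t x) \<le> 2 * real n / r * norm x"
      proof (cases "x = 0")
        case False
        define a where "a = r / (2 * norm x)"
        have a: "0 < a"
          using False r by (simp add: a_def)
        have "a *\<^sub>R x \<in> F n"
          using False r by (intro subsetD[OF r(2)]) (simp add: a_def)
        then have "norm (T t (a *\<^sub>R x)) \<le> real n"
          using t by (auto simp: F_def I_def)
        then show ?thesis
          using a False r by (simp add: blinfun.scaleR_right) (simp add: a_def field_simps)
      qed (simp add: blinfun.zero_right)
    qed (use r in simp)
    then show "norm (T t) \<le> max 1 (2 * real n / r)"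
      by simp
  qed auto
qed

text \<open>A time \<open>t\<close> is made of finitely many steps of length at most \<delta>, each
  costing a factor \<open>C\<close>.\<close>

lemma exponential_bound:
  obtains M \<omega> where "0 < M" "0 < \<omega>" "\<And>t. 0 \<le> t \<Longrightarrow> norm (T t) \<le> M * exp (\<omega> * t)"
proof -
  obtain \<delta> C where \<delta>: "0 < \<delta>" and C: "1 \<le> C" "\<And>t. 0 \<le> t \<Longrightarrow> t \<le> \<delta> \<Longrightarrow> norm (T t) \<le> C"
    using local_bound by blast
  have steps: "norm (T t) \<le> C ^ Suc n" if "0 \<le> t" "t \<le> real (Suc n) * \<delta>" for t n
    using that
  proof (induction n arbitrary: t)
    case (Suc n)
    show ?case
    proof (cases "t \<le> \<delta>")
      case True
      then have "norm (T t) \<le> C * 1"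
        using C(2) Suc.prems by simp
      also have "\<dots> \<le> C * C ^ Suc n"
        using C(1) by (intro mult_left_mono one_le_power) auto
      finally show ?thesis
        by simp
    next
      case False
      then have t: "0 \<le> t - \<delta>" "t - \<delta> \<le> real (Suc n) * \<delta>"
        using Suc.prems by (auto simp: algebra_simps)
      have "T t = T \<delta> o\<^sub>L T (t - \<delta>)"
        using C0_semigroup t(1) \<delta>
        by (metis C0_semigroup_def add.commute diff_add_cancel less_imp_le)
      then have "norm (T t) \<le> norm (T \<delta>) * norm (T (t - \<delta>))"
        by (simp add: norm_blinfun_compose)
      also have "\<dots> \<le> C * C ^ Suc n"
        using C \<delta> Suc.IH[OF t] by (intro mult_mono) auto
      finally show ?thesis
        by simp
    qed
  qed (use C in simp)
  show thesis
  \<comment> \<open>The summand 1 keeps the exponent positive even for \<open>C = 1\<close>.\<close>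
  proof (rule that[of C "(ln C + 1) / \<delta>"])
    fix t :: real
    assume t: "0 \<le> t"
    define n where "n = nat \<lfloor>t / \<delta>\<rfloor>"
    have n: "real n \<le> t / \<delta>" "t / \<delta> < real n + 1"
      using t \<delta> by (simp_all add: n_def)
    have "norm (T t) \<le> C ^ Suc n"
      using n(2) t \<delta> by (intro steps) (auto simp: field_simps)
    also have "\<dots> = C * exp (ln C * real n)"
      using C(1) by (simp add: exp_of_nat2_mult)
    also have "\<dots> \<le> C * exp ((ln C + 1) / \<delta> * t)"
    proof -
      have "ln C * real n \<le> (ln C + 1) * (t / \<delta>)"
        using C(1) n(1) t \<delta> by (intro mult_mono) auto
      then show ?thesis
        using C(1) by (simp add: ac_simps)
    qed
    finally show "norm (T t) \<le> C * exp ((ln C + 1) / \<delta> * t)" .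
  next
    show "0 < (ln C + 1) / \<delta>"
      using \<delta> ln_ge_zero[OF C(1)] by (intro divide_pos_pos add_nonneg_pos) auto
  qed (use C in auto)
qed

text \<open>Factoring out \<open>T s\<close> for the earlier time \<open>s\<close> reduces
  continuity from both sides to right continuity at 0.\<close>

lemma continuous_on_orbit: "continuous_on {0..} (\<lambda>t. T t x)"
proof -
  obtain M \<omega> where M: "0 < M" "0 < \<omega>" "\<And>t. 0 \<le> t \<Longrightarrow> norm (T t) \<le> M * exp (\<omega> * t)"
    using exponential_bound by blast
  have ordered: "dist (T s x) (T t x) \<le> M * exp (\<omega> * s) * dist (T (t - s) x) x"
    if "0 \<le> s" "s \<le> t" for s t
  proof -
    have "T s x - T t x = T s (x - T (t - s) x)"
      using T_add[of s "t - s" x] that by (simp add: blinfun.diff_right)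
    then have "dist (T s x) (T t x) \<le> norm (T s) * norm (x - T (t - s) x)"
      by (simp add: dist_norm norm_blinfun)
    also have "\<dots> \<le> M * exp (\<omega> * s) * norm (x - T (t - s) x)"
      using M(3)[OF that(1)] by (intro mult_right_mono) auto
    finally show ?thesis
      by (simp add: dist_norm norm_minus_commute)
  qed
  show ?thesis
    unfolding continuous_on_iff
  proof (intro ballI allI impI)
    fix t e :: real
    assume t: "t \<in> {0..}" and e: "0 < e"
    define B where "B = M * exp (\<omega> * (t + 1))"
    have B: "0 < B"
      using M by (simp add: B_def)
    have "\<forall>\<^sub>F h in at_right 0. dist (T h x) x < e / B"
      using T_right_continuous_0 by (rule tendstoD) (use B e in simp)
    then obtain b where b: "0 < b" "\<And>h. 0 < h \<Longrightarrow> h < b \<Longrightarrow> dist (T h x) x < e / B"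
      by (auto simp: eventually_at_right_field)
    have b': "dist (T h x) x < e / B" if "0 \<le> h" "h < b" for h
      using b(2)[of h] that B e by (cases "h = 0") (auto simp: T_0)
    have step: "dist (T s x) (T u x) < e" if "0 \<le> s" "s \<le> u" "u - s < b" "s \<le> t + 1" for s u
    proof -
      have "dist (T s x) (T u x) \<le> M * exp (\<omega> * s) * dist (T (u - s) x) x"
        by (rule ordered[OF that(1,2)])
      also have "\<dots> \<le> B * dist (T (u - s) x) x"
        using that(4) M by (intro mult_right_mono) (auto simp: B_def)
      also have "\<dots> < B * (e / B)"
        using that B by (intro mult_strict_left_mono b') auto
      finally show ?thesis
        using B by simp
    qed
    show "\<exists>d>0. \<forall>s\<in>{0..}. dist s t < d \<longrightarrow> dist (T s x) (T t x) < e"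
    proof (intro exI[of _ "min 1 b"] conjI ballI impI)
      fix s :: real
      assume s: "s \<in> {0..}" "dist s t < min 1 b"
      show "dist (T s x) (T t x) < e"
      proof (cases "s \<le> t")
        case True
        then show ?thesis
          using s t by (intro step) (auto simp: dist_real_def)
      next
        case False
        then show ?thesis
          using s t by (subst dist_commute, intro step) (auto simp: dist_real_def)
      qed
    qed (use b in simp)
  qed
qed

section \<open>The generator and integrals of orbits\<close>

lemma generatorI:
  assumes "((\<lambda>h. (1 / h) *\<^sub>R (T h x - x)) \<longlongrightarrow> y) (at_right 0)"
  shows "x \<in> D" "A x = y"
  using assms tendsto_Lim[OF _ assms] by (auto simp: generator_domain_def generator_def)

lemma generator_limit:
  assumes "x \<in> D"
  shows "((\<lambda>h. (1 / h) *\<^sub>R (T h x - x)) \<longlongrightarrow> A x) (at_right 0)"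
  using assms generatorI(2) by (auto simp: generator_domain_def)

lemma generator_linear:
  assumes "x \<in> D" "y \<in> D"
  shows "a *\<^sub>R x + b *\<^sub>R y \<in> D" "A (a *\<^sub>R x + b *\<^sub>R y) = a *\<^sub>R A x + b *\<^sub>R A y"
proof -
  have "((\<lambda>h. a *\<^sub>R ((1 / h) *\<^sub>R (T h x - x)) + b *\<^sub>R ((1 / h) *\<^sub>R (T h y - y)))
    \<longlongrightarrow> a *\<^sub>R A x + b *\<^sub>R A y) (at_right 0)"
    by (intro tendsto_intros generator_limit assms)
  then have "((\<lambda>h. (1 / h) *\<^sub>R (T h (a *\<^sub>R x + b *\<^sub>R y) - (a *\<^sub>R x + b *\<^sub>R y)))
    \<longlongrightarrow> a *\<^sub>R A x + b *\<^sub>R A y) (at_right 0)"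
    by (rule Lim_transform_eventually)
       (simp add: blinfun.add_right blinfun.scaleR_right algebra_simps)
  then show "a *\<^sub>R x + b *\<^sub>R y \<in> D" "A (a *\<^sub>R x + b *\<^sub>R y) = a *\<^sub>R A x + b *\<^sub>R A y"
    by (rule generatorI)+
qed

lemma generator_invariant:
  assumes "x \<in> D" "0 \<le> t"
  shows "T t x \<in> D" "A (T t x) = T t (A x)"
proof -
  have "((\<lambda>h. T t ((1 / h) *\<^sub>R (T h x - x))) \<longlongrightarrow> T t (A x)) (at_right 0)"
    by (intro tendsto_intros generator_limit assms)
  moreover have "\<forall>\<^sub>F h in at_right 0.
      T t ((1 / h) *\<^sub>R (T h x - x)) = (1 / h) *\<^sub>R (T h (T t x) - T t x)"
    using eventually_at_right_less[of 0]
    by eventually_elim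
       (use assms(2) in \<open>simp add: blinfun.diff_right blinfun.scaleR_right T_commute[of t]\<close>)
  ultimately have "((\<lambda>h. (1 / h) *\<^sub>R (T h (T t x) - T t x)) \<longlongrightarrow> T t (A x)) (at_right 0)"
    by (rule Lim_transform_eventually)
  then show "T t x \<in> D" "A (T t x) = T t (A x)"
    by (rule generatorI)+
qed

text \<open>The fundamental theorem of calculus, brought to the one-sided form in which the
  generator is defined.\<close>

lemma integral_orbit_difference_quotient:
  assumes "0 \<le> a"
  shows "((\<lambda>h. (1 / h) *\<^sub>R (integral {0..a + h} (\<lambda>s. T s x) - integral {0..a} (\<lambda>s. T s x)))
    \<longlongrightarrow> T a x) (at_right 0)"
proof -
  have "((\<lambda>u. integral {0..u} (\<lambda>s. T s x)) has_vector_derivative T a x) (at a within {0..a + 1})"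
    using assms
    by (intro integral_has_vector_derivative continuous_on_subset[OF continuous_on_orbit]) auto
  then have "((\<lambda>u. integral {0..u} (\<lambda>s. T s x)) has_vector_derivative T a x) (at a within {a..a + 1})"
    by (rule has_vector_derivative_within_subset) (use assms in auto)
  then have "((\<lambda>u. integral {0..u} (\<lambda>s. T s x)) has_vector_derivative T a x) (at_right a)"
    by (simp add: at_within_Icc_at_right)
  then have "((\<lambda>u. (1 / norm (u - a)) *\<^sub>R
      (integral {0..u} (\<lambda>s. T s x) - (integral {0..a} (\<lambda>s. T s x) + (u - a) *\<^sub>R T a x)))
      \<longlongrightarrow> 0) (at_right a)"
    by (simp add: has_vector_derivative_def has_derivative_within)
  then have "((\<lambda>h. (1 / norm h) *\<^sub>R
      (integral {0..a + h} (\<lambda>s. T s x) - (integral {0..a} (\<lambda>s. T s x) + h *\<^sub>R T a x)))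
      \<longlongrightarrow> 0) (at_right 0)"
    by (subst (asm) filterlim_at_right_to_0) (simp add: add.commute)
  moreover have "\<forall>\<^sub>F h in at_right 0. (1 / norm h) *\<^sub>R
      (integral {0..a + h} (\<lambda>s. T s x) - (integral {0..a} (\<lambda>s. T s x) + h *\<^sub>R T a x))
      = (1 / h) *\<^sub>R (integral {0..a + h} (\<lambda>s. T s x) - integral {0..a} (\<lambda>s. T s x)) - T a x"
    using eventually_at_right_less[of 0] by eventually_elim (simp add: algebra_simps)
  ultimately show ?thesis
    by (rule LIM_zero_cancel[OF Lim_transform_eventually])
qed

text \<open>The shift identity \<open>T h (F a) = F (a + h) - F h\<close> turns the quotient
  defining \<open>A (F a)\<close> into a difference of two difference quotients of \<open>F\<close>,
  at \<open>a\<close> and at 0.\<close>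

lemma generator_integral_orbit:
  assumes a: "0 \<le> a"
  shows "integral {0..a} (\<lambda>s. T s x) \<in> D"
    and "A (integral {0..a} (\<lambda>s. T s x)) = T a x - x"
proof -
  define F where "F u = integral {0..u} (\<lambda>s. T s x)" for u
  have int: "(\<lambda>s. T s x) integrable_on {u..v}" if "0 \<le> u" for u v
    using that
    by (intro integrable_continuous_real continuous_on_subset[OF continuous_on_orbit]) auto
  have shift: "T h (F a) = F (a + h) - F h" if h: "0 < h" for h
  proof -
    have "T h (F a) = integral {0..a} (\<lambda>s. T h (T s x))"
      using int by (simp add: F_def integral_blinfun_apply)
    also have "\<dots> = integral {0..a} ((\<lambda>s. T s x) \<circ> (+) h)"
      using h by (intro integral_cong) (simp add: T_add)
    also have "\<dots> = integral {h..a + h} (\<lambda>s. T s x)"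
      by (subst integral_shift_Icc_real) simp
    also have "\<dots> = F (a + h) - F h"
      using Henstock_Kurzweil_Integration.integral_combine[OF less_imp_le[OF h] _ int[OF order_refl, of "a + h"]] a h
      by (simp add: F_def algebra_simps)
    finally show ?thesis .
  qed
  have "((\<lambda>h. (1 / h) *\<^sub>R (F (a + h) - F a) - (1 / h) *\<^sub>R (F (0 + h) - F 0)) \<longlongrightarrow> T a x - T 0 x)
      (at_right 0)"
    unfolding F_def using a by (intro tendsto_diff integral_orbit_difference_quotient) auto
  moreover have "\<forall>\<^sub>F h in at_right 0. (1 / h) *\<^sub>R (F (a + h) - F a) - (1 / h) *\<^sub>R (F (0 + h) - F 0)
      = (1 / h) *\<^sub>R (T h (F a) - F a)"
    using eventually_at_right_less[of 0]
  proof eventually_elim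
    case (elim h)
    have "F 0 = 0"
      by (simp add: F_def)
    then show ?case
      by (simp add: shift[OF elim] algebra_simps)
  qed
  ultimately have "((\<lambda>h. (1 / h) *\<^sub>R (T h (F a) - F a)) \<longlongrightarrow> T a x - x) (at_right 0)"
    unfolding T_0 by (rule Lim_transform_eventually)
  then show "integral {0..a} (\<lambda>s. T s x) \<in> D"
    and "A (integral {0..a} (\<lambda>s. T s x)) = T a x - x"
    unfolding F_def by (rule generatorI)+
qed

text \<open>The means of an orbit over \<open>[0, h]\<close> lie in \<open>D\<close> and tend to its
  initial value.\<close>

lemma generator_domain_dense: "closure D = UNIV"
proof (intro UNIV_eq_I[symmetric])
  fix x
  have "((\<lambda>h. (1 / h) *\<^sub>R integral {0..h} (\<lambda>s. T s x)) \<longlongrightarrow> x) (at_right 0)"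
    using integral_orbit_difference_quotient[of 0 x] by (simp add: T_0)
  moreover have "\<forall>\<^sub>F h in at_right 0. (1 / h) *\<^sub>R integral {0..h} (\<lambda>s. T s x) \<in> closure D"
    using eventually_at_right_less[of 0]
  proof eventually_elim
    case (elim h)
    then have "integral {0..h} (\<lambda>s. T s x) \<in> D"
      by (intro generator_integral_orbit(1)) simp
    from generator_linear(1)[OF this this, of "1 / h" 0]
    show ?case
      using closure_subset by auto
  qed
  ultimately show "x \<in> closure D"
    by (intro Lim_in_closed_set[of "closure D"]) auto
qed

section \<open>Surjectivity of \<open>\<mu> - A\<close>\<close>

text \<open>Replaces the Laplace transform by an integral over a bounded interval: contractivity
  gives \<open>u\<close> with \<open>u - T a u = z\<close>, and the integral of the orbit of
  \<open>u\<close> up to time \<open>a\<close> is a preimage of \<open>z\<close>.\<close>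

lemma generator_surj:
  assumes a: "0 \<le> a" and contraction: "norm (T a) < 1"
  shows "\<exists>y\<in>D. - A y = z"
proof -
  have "\<exists>!u. T a u + z = u"
    by (rule banach_fix_type[OF norm_ge_zero contraction])
       (simp add: dist_norm norm_blinfun flip: blinfun.diff_right)
  then obtain u where u: "T a u + z = u"
    by blast
  have "- A (integral {0..a} (\<lambda>s. T s u)) = u - T a u"
    by (simp add: generator_integral_orbit(2)[OF a])
  also have "\<dots> = z"
    using u by (metis add_diff_cancel_left')
  finally show ?thesis
    using generator_integral_orbit(1)[OF a] by blast
qed

text \<open>Its generator is \<open>A - \<mu>\<close>, so a statement about the negative of a
  generator becomes one about \<open>\<mu> - A\<close>.\<close>

definition rescaled :: "real \<Rightarrow> real \<Rightarrow> ('a \<Rightarrow>\<^sub>L 'a)" where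
  "rescaled \<mu> t = exp (- \<mu> * t) *\<^sub>R T t"

lemma rescaled_apply: "rescaled \<mu> t x = exp (- \<mu> * t) *\<^sub>R T t x"
  by (simp add: rescaled_def scaleR_blinfun.rep_eq)

lemma rescaled_semigroup: "strongly_continuous_semigroup (rescaled \<mu>)"
proof
  have "rescaled \<mu> 0 = id_blinfun"
    by (simp add: blinfun_eqI rescaled_apply T_0)
  moreover have "rescaled \<mu> (s + t) = rescaled \<mu> s o\<^sub>L rescaled \<mu> t" if "0 \<le> s" "0 \<le> t" for s t
    using that
    by (intro blinfun_eqI)
       (simp add: rescaled_apply T_add blinfun.scaleR_right exp_add[symmetric] algebra_simps)
  moreover have "((\<lambda>t. rescaled \<mu> t x) \<longlongrightarrow> x) (at_right 0)" for x
  proof -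
    have "((\<lambda>t. exp (- \<mu> * t) *\<^sub>R T t x) \<longlongrightarrow> exp (- \<mu> * 0) *\<^sub>R x) (at_right 0)"
      by (intro tendsto_intros T_right_continuous_0)
    then show ?thesis
      by (simp add: rescaled_apply)
  qed
  ultimately show "C0_semigroup (rescaled \<mu>)"
    by (simp add: C0_semigroup_def)
qed

text \<open>The product rule for \<open>T h\<close> as \<open>exp (\<mu> * h)\<close> times
  \<open>rescaled \<mu> h\<close>; the scalar factor contributes the term
  \<open>\<mu> x\<close>.\<close>

lemma generator_rescaled:
  assumes "x \<in> generator_domain (rescaled \<mu>)"
  shows "x \<in> D" "generator (rescaled \<mu>) x = A x - \<mu> *\<^sub>R x"
proof -
  interpret R: strongly_continuous_semigroup "rescaled \<mu>"
    by (rule rescaled_semigroup)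
  have "((\<lambda>h::real. (exp (\<mu> * h) - 1) / h) \<longlongrightarrow> \<mu>) (at 0)"
  proof -
    have "((\<lambda>h. exp (\<mu> * h)) has_real_derivative \<mu>) (at 0)"
      by (auto intro!: derivative_eq_intros)
    from DERIV_D[OF this] show ?thesis
      by simp
  qed
  then have "((\<lambda>h::real. (exp (\<mu> * h) - 1) / h) \<longlongrightarrow> \<mu>) (at_right 0)"
    by (rule tendsto_mono[OF at_le, rotated]) simp
  moreover have "((\<lambda>h. exp (\<mu> * h)) \<longlongrightarrow> 1) (at_right 0)"
    by (auto intro!: tendsto_eq_intros)
  ultimately have "((\<lambda>h. exp (\<mu> * h) *\<^sub>R ((1 / h) *\<^sub>R (rescaled \<mu> h x - x)) + ((exp (\<mu> * h) - 1) / h) *\<^sub>R x)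
      \<longlongrightarrow> 1 *\<^sub>R generator (rescaled \<mu>) x + \<mu> *\<^sub>R x) (at_right 0)"
    by (intro tendsto_intros R.generator_limit assms)
  then have "((\<lambda>h. (1 / h) *\<^sub>R (T h x - x)) \<longlongrightarrow> 1 *\<^sub>R generator (rescaled \<mu>) x + \<mu> *\<^sub>R x) (at_right 0)"
  proof (rule Lim_transform_eventually)
    have "exp (\<mu> * h) *\<^sub>R rescaled \<mu> h x = T h x" for h
      by (simp add: rescaled_apply flip: exp_add)
    moreover have "e *\<^sub>R (c *\<^sub>R (w - x)) + ((e - 1) * c) *\<^sub>R x = c *\<^sub>R (e *\<^sub>R w - x)"
      for e c :: real and w
      by (simp add: algebra_simps)
    ultimately have "exp (\<mu> * h) *\<^sub>R ((1 / h) *\<^sub>R (rescaled \<mu> h x - x)) + ((exp (\<mu> * h) - 1) / h) *\<^sub>R x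
        = (1 / h) *\<^sub>R (T h x - x)" for h
      by (metis mult_1_right times_divide_eq_right)
    then show "\<forall>\<^sub>F h in at_right 0.
        exp (\<mu> * h) *\<^sub>R ((1 / h) *\<^sub>R (rescaled \<mu> h x - x)) + ((exp (\<mu> * h) - 1) / h) *\<^sub>R x
        = (1 / h) *\<^sub>R (T h x - x)"
      by simp
  qed
  from generatorI[OF this] show "x \<in> D" "generator (rescaled \<mu>) x = A x - \<mu> *\<^sub>R x"
    by simp_all
qed

text \<open>Above the growth rate the rescaled semigroup decays, so it is a strict contraction at
  some time \<open>a\<close>, as \<open>generator_surj\<close> demands.\<close>

lemma generator_range:
  assumes M: "\<And>t. 0 \<le> t \<Longrightarrow> norm (T t) \<le> M * exp (\<omega> * t)" and \<mu>: "\<omega> < \<mu>"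
  shows "\<exists>y\<in>D. \<mu> *\<^sub>R y - A y = z"
proof -
  interpret R: strongly_continuous_semigroup "rescaled \<mu>"
    by (rule rescaled_semigroup)
  have "((\<lambda>t. M * exp ((\<omega> - \<mu>) * t)) \<longlongrightarrow> 0) at_top"
    using \<mu>
    by (intro tendsto_mult_right_zero filterlim_compose[OF exp_at_bot]
          filterlim_tendsto_neg_mult_at_bot[OF tendsto_const _ filterlim_ident]) simp
  then have "\<forall>\<^sub>F t in at_top. M * exp ((\<omega> - \<mu>) * t) < 1"
    by (rule order_tendstoD) simp
  then obtain a where a: "0 \<le> a" "M * exp ((\<omega> - \<mu>) * a) < 1"
    using eventually_happens[OF eventually_conj[OF eventually_ge_at_top[of 0]]] by fastforce
  have "norm (rescaled \<mu> a) = exp (- \<mu> * a) * norm (T a)"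
    by (simp add: rescaled_def)
  also have "\<dots> \<le> exp (- \<mu> * a) * (M * exp (\<omega> * a))"
    using M[OF a(1)] by (intro mult_left_mono) auto
  also have "\<dots> = M * exp ((\<omega> - \<mu>) * a)"
    by (simp add: left_diff_distrib mult.left_commute flip: exp_add)
  also have "\<dots> < 1"
    by (fact a(2))
  finally obtain y where y: "y \<in> generator_domain (rescaled \<mu>)" "- generator (rescaled \<mu>) y = z"
    using R.generator_surj[OF a(1)] by blast
  then show ?thesis
    using generator_rescaled[OF y(1)] by (intro bexI[of _ y]) auto
qed

end

section \<open>The exponential formula\<close>

text \<open>
  After passing to an equivalent norm \<open>N\<close>, every strongly continuous semigroup is
  quasi-contractive. This turns estimates for powers of the resolvent into products of estimates
  for a single resolvent.
\<close>

locale quasi_contraction_semigroup = strongly_continuous_semigroup T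
  for T :: "real \<Rightarrow> ('a::banach \<Rightarrow>\<^sub>L 'a)" +
  fixes N :: "'a \<Rightarrow> real" and M \<omega> :: real
  assumes norm_le_N: "norm x \<le> N x"
    and N_le_norm: "N x \<le> M * norm x"
    and N_add: "N (x + y) \<le> N x + N y"
    and N_scaleR: "N (a *\<^sub>R x) = \<bar>a\<bar> * N x"
    and N_T: "0 \<le> t \<Longrightarrow> N (T t x) \<le> exp (\<omega> * t) * N x"
    and \<omega>_pos: "0 < \<omega>"
    and M_nonneg: "0 \<le> M"
begin

lemma N_nonneg: "0 \<le> N x"
  using norm_le_N[of x] norm_ge_zero[of x] by linarith

lemma N_0: "N 0 = 0"
  using N_scaleR[of 0 0] by simp

lemma N_minus_commute: "N (x - y) = N (y - x)"
  using N_scaleR[of "- 1" "y - x"] by simp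

lemma tendsto_N:
  assumes "(f \<longlongrightarrow> l) F"
  shows "((\<lambda>x. N (f x)) \<longlongrightarrow> N l) F"
proof (rule LIM_zero_cancel[OF Lim_null_comparison])
  show "\<forall>\<^sub>F x in F. norm (N (f x) - N l) \<le> M * norm (f x - l)"
  proof (rule always_eventually, rule allI)
    fix x
    have "N (f x) \<le> N (f x - l) + N l" "N l \<le> N (f x - l) + N (f x)"
      using N_add[of "f x - l" l] N_add[of "l - f x" "f x"] by (simp_all add: N_minus_commute)
    then show "norm (N (f x) - N l) \<le> M * norm (f x - l)"
      using N_le_norm[of "f x - l"] by (simp add: abs_if)
  qed
  show "((\<lambda>x. M * norm (f x - l)) \<longlongrightarrow> 0) F"
    using assms by (intro tendsto_mult_right_zero tendsto_norm_zero LIM_zero)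
qed

text \<open>With the difference quotient in place of \<open>A x\<close> the vector on the right is
  \<open>y\<close>, and \<open>(\<mu> + 1 / h) x = y + (1 / h) T h x\<close>. Quasi-contractivity
  bounds the last term, so the terms of order \<open>1 / h\<close> cancel up to a quotient that
  tends to \<omega>.\<close>

lemma generator_dissipative:
  assumes x: "x \<in> D" and \<mu>: "\<omega> < \<mu>"
  shows "(\<mu> - \<omega>) * N x \<le> N (\<mu> *\<^sub>R x - A x)"
proof (rule tendsto_le)
  have "((\<lambda>h. exp (\<omega> * h)) has_real_derivative \<omega>) (at 0)"
    by (auto intro!: derivative_eq_intros)
  then have "((\<lambda>h. (exp (\<omega> * h) - 1) / h) \<longlongrightarrow> \<omega>) (at 0)"
    using DERIV_D by fastforce
  then have "((\<lambda>h. (exp (\<omega> * h) - 1) / h) \<longlongrightarrow> \<omega>) (at_right 0)"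
    by (rule tendsto_mono[OF at_le, rotated]) simp
  then show "((\<lambda>h. (\<mu> - (exp (\<omega> * h) - 1) / h) * N x) \<longlongrightarrow> (\<mu> - \<omega>) * N x) (at_right 0)"
    by (intro tendsto_intros)
  show "((\<lambda>h. N (\<mu> *\<^sub>R x - (1 / h) *\<^sub>R (T h x - x))) \<longlongrightarrow> N (\<mu> *\<^sub>R x - A x)) (at_right 0)"
    by (intro tendsto_N tendsto_intros generator_limit x)
  show "\<forall>\<^sub>F h in at_right 0.
      (\<mu> - (exp (\<omega> * h) - 1) / h) * N x \<le> N (\<mu> *\<^sub>R x - (1 / h) *\<^sub>R (T h x - x))"
    using eventually_at_right_less[of 0]
  proof eventually_elim
    case (elim h)
    define y where "y = \<mu> *\<^sub>R x - (1 / h) *\<^sub>R (T h x - x)"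
    have "(\<mu> + 1 / h) * N x = N ((\<mu> + 1 / h) *\<^sub>R x)"
      using elim \<mu> \<omega>_pos by (simp add: N_scaleR)
    also have "(\<mu> + 1 / h) *\<^sub>R x = y + (1 / h) *\<^sub>R T h x"
      by (simp add: y_def algebra_simps)
    also have "N \<dots> \<le> N y + (1 / h) * N (T h x)"
      using N_add[of y "(1 / h) *\<^sub>R T h x"] elim by (simp add: N_scaleR)
    also have "\<dots> \<le> N y + (1 / h) * (exp (\<omega> * h) * N x)"
      using elim by (intro add_left_mono mult_left_mono N_T) auto
    finally show ?case
      unfolding y_def[symmetric] by (simp add: algebra_simps diff_divide_distrib)
  qed
qed simp

section \<open>Resolvents\<close>

text \<open>Injectivity is dissipativity at \<open>x - y\<close>; surjectivity is
  \<open>generator_range\<close>, with a growth bound in the original norm recovered from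
  \<open>N\<close>.\<close>

lemma resolvent_bij:
  assumes \<mu>: "\<omega> < \<mu>"
  shows "bij_betw (\<lambda>x. \<mu> *\<^sub>R x - A x) D UNIV"
proof (rule bij_betw_imageI)
  show "inj_on (\<lambda>x. \<mu> *\<^sub>R x - A x) D"
  proof (rule inj_onI)
    fix x y
    assume x: "x \<in> D" and y: "y \<in> D" and eq: "\<mu> *\<^sub>R x - A x = \<mu> *\<^sub>R y - A y"
    have "x - y \<in> D" "A (x - y) = A x - A y"
      using generator_linear[OF x y, of 1 "- 1"] by simp_all
    then have "\<mu> *\<^sub>R (x - y) - A (x - y) = (\<mu> *\<^sub>R x - A x) - (\<mu> *\<^sub>R y - A y)"
      by (simp add: scaleR_diff_right)
    then have "N (\<mu> *\<^sub>R (x - y) - A (x - y)) = 0"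
      by (simp only: eq diff_self N_0)
    with generator_dissipative[OF \<open>x - y \<in> D\<close> \<mu>] have "(\<mu> - \<omega>) * N (x - y) \<le> 0"
      by simp
    then have "N (x - y) \<le> 0"
      using \<mu> by (simp add: mult_le_0_iff)
    then have "norm (x - y) \<le> 0"
      using norm_le_N order_trans by blast
    then show "x = y"
      by simp
  qed
  have "norm (T t) \<le> M * exp (\<omega> * t)" if "0 \<le> t" for t
  proof (rule norm_blinfun_bound)
    fix x
    have "norm (T t x) \<le> exp (\<omega> * t) * N x"
      using norm_le_N N_T[OF that] by (rule order_trans)
    also have "\<dots> \<le> exp (\<omega> * t) * (M * norm x)"
      by (intro mult_left_mono N_le_norm) simp
    finally show "norm (T t x) \<le> M * exp (\<omega> * t) * norm x"
      by (simp add: ac_simps)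
  qed (simp add: M_nonneg)
  then have "\<exists>y\<in>D. \<mu> *\<^sub>R y - A y = z" for z
    using \<mu> by (rule generator_range)
  then have "z \<in> (\<lambda>x. \<mu> *\<^sub>R x - A x) ` D" for z
    unfolding image_iff by (simp only: eq_commute[of z])
  then show "(\<lambda>x. \<mu> *\<^sub>R x - A x) ` D = UNIV"
    by (intro UNIV_eq_I[symmetric])
qed

lemma resolvent_in_domain: "\<omega> < \<mu> \<Longrightarrow> resolvent D A \<mu> z \<in> D"
  using resolvent_bij[of \<mu>] unfolding resolvent_def
  by (intro inv_into_into) (auto simp: bij_betw_def)

lemma resolvent_right: "\<omega> < \<mu> \<Longrightarrow> \<mu> *\<^sub>R resolvent D A \<mu> z - A (resolvent D A \<mu> z) = z"
  using bij_betw_inv_into_right[OF resolvent_bij, of \<mu> z] by (simp add: resolvent_def)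

lemma resolvent_left: "\<omega> < \<mu> \<Longrightarrow> x \<in> D \<Longrightarrow> resolvent D A \<mu> (\<mu> *\<^sub>R x - A x) = x"
  using bij_betw_inv_into_left[OF resolvent_bij, of \<mu> x] by (simp add: resolvent_def)

lemma resolvent_linear:
  assumes \<mu>: "\<omega> < \<mu>"
  shows "resolvent D A \<mu> (a *\<^sub>R x + b *\<^sub>R y) = a *\<^sub>R resolvent D A \<mu> x + b *\<^sub>R resolvent D A \<mu> y"
proof -
  define u v where "u = resolvent D A \<mu> x" and "v = resolvent D A \<mu> y"
  have uv: "u \<in> D" "v \<in> D" "\<mu> *\<^sub>R u - A u = x" "\<mu> *\<^sub>R v - A v = y"
    using resolvent_in_domain[OF \<mu>] resolvent_right[OF \<mu>] by (auto simp: u_def v_def)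
  have "a *\<^sub>R x + b *\<^sub>R y = \<mu> *\<^sub>R (a *\<^sub>R u + b *\<^sub>R v) - A (a *\<^sub>R u + b *\<^sub>R v)"
    by (simp add: generator_linear(2)[OF uv(1,2)] flip: uv(3,4)) (simp add: algebra_simps)
  then have "resolvent D A \<mu> (a *\<^sub>R x + b *\<^sub>R y) = a *\<^sub>R u + b *\<^sub>R v"
    using resolvent_left[OF \<mu> generator_linear(1)[OF uv(1,2)]] by simp
  then show ?thesis
    by (simp add: u_def v_def)
qed

lemma resolvent_diff:
  "\<omega> < \<mu> \<Longrightarrow> resolvent D A \<mu> (x - y) = resolvent D A \<mu> x - resolvent D A \<mu> y"
  using resolvent_linear[of \<mu> 1 x "- 1" y] by simp

lemma resolvent_scaleR: "\<omega> < \<mu> \<Longrightarrow> resolvent D A \<mu> (a *\<^sub>R x) = a *\<^sub>R resolvent D A \<mu> x"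
  using resolvent_linear[of \<mu> a x 0 x] by simp

lemma N_resolvent:
  assumes \<mu>: "\<omega> < \<mu>"
  shows "N (resolvent D A \<mu> z) \<le> N z / (\<mu> - \<omega>)"
  using generator_dissipative[OF resolvent_in_domain[OF \<mu>, of z] \<mu>] \<mu>
  by (simp add: resolvent_right field_simps)

text \<open>Makes the locality hypothesis on resolvents available for all large \<mu>.\<close>

lemma real_resolvent_setI:
  assumes \<mu>: "\<omega> < \<mu>"
  shows "\<mu> \<in> real_resolvent_set D A"
proof -
  have "bounded_linear (resolvent D A \<mu>)"
  proof (rule bounded_linear_intro)
    show "resolvent D A \<mu> (x + y) = resolvent D A \<mu> x + resolvent D A \<mu> y" for x y
      using resolvent_linear[OF \<mu>, of 1 x 1 y] by simp
    show "resolvent D A \<mu> (a *\<^sub>R x) = a *\<^sub>R resolvent D A \<mu> x" for a x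
      by (rule resolvent_scaleR[OF \<mu>])
    fix x
    have "norm (resolvent D A \<mu> x) \<le> N x / (\<mu> - \<omega>)"
      using norm_le_N N_resolvent[OF \<mu>] by (rule order_trans)
    also have "\<dots> \<le> M * norm x / (\<mu> - \<omega>)"
      using \<mu> by (intro divide_right_mono N_le_norm) simp
    finally show "norm (resolvent D A \<mu> x) \<le> norm x * (M / (\<mu> - \<omega>))"
      by (simp add: ac_simps)
  qed
  then show ?thesis
    using resolvent_bij[OF \<mu>] by (simp add: real_resolvent_set_def)
qed

section \<open>Convergence of the implicit Euler scheme\<close>

text \<open>A step of length \<open>1 / \<mu>\<close> of the implicit Euler scheme for \<open>u' = A u\<close>.\<close>

definition euler :: "real \<Rightarrow> 'a \<Rightarrow> 'a" where
  "euler \<mu> x = \<mu> *\<^sub>R resolvent D A \<mu> x"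

lemma euler_diff: "\<omega> < \<mu> \<Longrightarrow> euler \<mu> (x - y) = euler \<mu> x - euler \<mu> y"
  by (simp add: euler_def resolvent_diff scaleR_diff_right)

lemma N_euler:
  assumes "\<omega> < \<mu>"
  shows "N (euler \<mu> x) \<le> \<mu> / (\<mu> - \<omega>) * N x"
proof -
  have "\<mu> * N (resolvent D A \<mu> x) \<le> \<mu> * (N x / (\<mu> - \<omega>))"
    using assms \<omega>_pos by (intro mult_left_mono N_resolvent) auto
  then show ?thesis
    using assms \<omega>_pos by (simp add: euler_def N_scaleR)
qed

text \<open>
  The local error factors through \<open>T (k h)\<close>; hence it is controlled by \<open>x\<close> alone and no second
  power of \<open>A\<close> is needed.
\<close>

lemma euler_local_error:
  assumes \<mu>: "\<omega> < \<mu>" and x: "x \<in> D" and k: "0 \<le> k"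
  shows "N (T (1 / \<mu>) (T (k / \<mu>) x) - euler \<mu> (T (k / \<mu>) x))
    \<le> N (\<mu> *\<^sub>R (T (1 / \<mu>) x - x) - T (1 / \<mu>) (A x)) * exp (\<omega> * (k / \<mu>)) / (\<mu> - \<omega>)"
proof -
  define h s where "h = 1 / \<mu>" and "s = k / \<mu>"
  have hs: "0 \<le> h" "0 \<le> s"
    using \<mu> \<omega>_pos k by (auto simp: h_def s_def)
  define z where "z = \<mu> *\<^sub>R (T h x - x) - T h (A x)"
  have y: "T s (T h x) \<in> D" "A (T s (T h x)) = T s (T h (A x))"
    using generator_invariant x hs by simp_all
  \<comment> \<open>Both terms become values of one resolvent: the exact one because
    \<open>T s (T h x)\<close> lies in \<open>D\<close>, the Euler one by definition. The argument
    left over is \<open>T s z\<close>, with \<open>z\<close> independent of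
    \<open>s\<close>.\<close>
  have "T h (T s x) - euler \<mu> (T s x)
      = resolvent D A \<mu> (\<mu> *\<^sub>R T s (T h x) - A (T s (T h x))) - resolvent D A \<mu> (\<mu> *\<^sub>R T s x)"
    by (simp only: resolvent_left[OF \<mu> y(1)] euler_def resolvent_scaleR[OF \<mu>] T_commute[OF hs])
  also have "\<dots> = resolvent D A \<mu> (\<mu> *\<^sub>R T s (T h x) - A (T s (T h x)) - \<mu> *\<^sub>R T s x)"
    by (simp add: resolvent_diff[OF \<mu>])
  also have "\<mu> *\<^sub>R T s (T h x) - A (T s (T h x)) - \<mu> *\<^sub>R T s x = T s z"
    by (simp add: z_def y(2) blinfun.diff_right blinfun.scaleR_right scaleR_diff_right)
  finally have "N (T h (T s x) - euler \<mu> (T s x)) \<le> N (T s z) / (\<mu> - \<omega>)"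
    using N_resolvent[OF \<mu>] by simp
  also have "\<dots> \<le> (exp (\<omega> * s) * N z) / (\<mu> - \<omega>)"
    using \<mu> hs by (intro divide_right_mono N_T) auto
  finally show ?thesis
    by (simp add: h_def s_def z_def ac_simps)
qed

text \<open>Each step adds a local error and amplifies the inherited one by at most
  \<open>q\<close>.\<close>

lemma euler_global_error:
  assumes \<mu>: "\<omega> < \<mu>" and x: "x \<in> D"
  shows "N (T (real k / \<mu>) x - (euler \<mu> ^^ k) x)
    \<le> real k / \<mu> * (\<mu> / (\<mu> - \<omega>)) ^ k * N (\<mu> *\<^sub>R (T (1 / \<mu>) x - x) - T (1 / \<mu>) (A x))"
proof -
  define q where "q = \<mu> / (\<mu> - \<omega>)"
  define \<epsilon> where "\<epsilon> = N (\<mu> *\<^sub>R (T (1 / \<mu>) x - x) - T (1 / \<mu>) (A x))"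
  have \<mu>0: "0 < \<mu>"
    using \<mu> \<omega>_pos by simp
  have q0: "0 \<le> q"
    using \<mu> \<mu>0 by (simp add: q_def)
  \<comment> \<open>This lets the growth of the semigroup be absorbed by the same factor
    \<open>q\<close> as the growth of the scheme.\<close>
  have "1 + - (\<omega> / \<mu>) \<le> exp (- (\<omega> / \<mu>))"
    by (rule exp_ge_add_one_self)
  then have q: "exp (\<omega> / \<mu>) \<le> q"
    using \<mu> \<mu>0 by (simp add: q_def exp_minus field_simps)
  show ?thesis
    unfolding q_def[symmetric] \<epsilon>_def[symmetric]
  proof (induction k)
    case (Suc k)
    define y where "y = T (real k / \<mu>) x"
    have "exp (\<omega> * (real k / \<mu>)) = exp (\<omega> / \<mu>) ^ k"
      by (simp add: exp_of_nat_mult[symmetric] ac_simps)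
    also have "\<dots> \<le> q ^ k"
      by (intro power_mono q) simp
    finally have "\<epsilon> * exp (\<omega> * (real k / \<mu>)) / (\<mu> - \<omega>) \<le> \<epsilon> * q ^ k / (\<mu> - \<omega>)"
      using \<mu> by (intro divide_right_mono mult_left_mono) (auto simp: \<epsilon>_def N_nonneg)
    also have "\<dots> = 1 / \<mu> * q ^ Suc k * \<epsilon>"
      using \<mu>0 by (simp add: q_def)
    finally have local_error: "N (T (1 / \<mu>) y - euler \<mu> y) \<le> 1 / \<mu> * q ^ Suc k * \<epsilon>"
      using euler_local_error[OF \<mu> x, of "real k"] by (simp add: y_def \<epsilon>_def)
    have "T (real (Suc k) / \<mu>) x = T (1 / \<mu>) y"
      using T_add[of "1 / \<mu>" "real k / \<mu>" x] \<mu>0 by (simp add: y_def add_divide_distrib)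
    then have "T (real (Suc k) / \<mu>) x - (euler \<mu> ^^ Suc k) x
        = (T (1 / \<mu>) y - euler \<mu> y) + euler \<mu> (y - (euler \<mu> ^^ k) x)"
      by (simp add: euler_diff[OF \<mu>])
    also have "N \<dots> \<le> N (T (1 / \<mu>) y - euler \<mu> y) + N (euler \<mu> (y - (euler \<mu> ^^ k) x))"
      by (rule N_add)
    also have "N (euler \<mu> (y - (euler \<mu> ^^ k) x)) \<le> q * N (y - (euler \<mu> ^^ k) x)"
      using N_euler[OF \<mu>] by (simp add: q_def)
    also have "\<dots> \<le> q * (real k / \<mu> * q ^ k * \<epsilon>)"
      using Suc.IH q0 by (intro mult_left_mono) (simp_all add: y_def)
    finally have "N (T (real (Suc k) / \<mu>) x - (euler \<mu> ^^ Suc k) x)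
        \<le> 1 / \<mu> * q ^ Suc k * \<epsilon> + q * (real k / \<mu> * q ^ k * \<epsilon>)"
      using local_error by simp
    also have "\<dots> = real (Suc k) / \<mu> * q ^ Suc k * \<epsilon>"
      by (simp add: add_divide_distrib algebra_simps)
    finally show ?case .
  qed (simp add: T_0 N_0)
qed

text \<open>With \<open>\<mu> = n / t\<close> and \<open>k = n\<close> the global error bound is
  \<open>t * q n * \<epsilon> (t / n)\<close>: here \<open>q n\<close> tends to
  \<open>exp (\<omega> * t)\<close>, while the two terms inside \<epsilon> both tend to
  \<open>A x\<close>.\<close>

lemma exponential_formula:
  assumes x: "x \<in> D" and t: "0 < t"
  shows "(\<lambda>n. (euler (real n / t) ^^ n) x) \<longlonglongrightarrow> T t x"
proof (rule LIM_zero_cancel[OF Lim_null_comparison])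
  define \<epsilon> where "\<epsilon> h = N ((1 / h) *\<^sub>R (T h x - x) - T h (A x))" for h
  \<comment> \<open>This is \<open>(\<mu> / (\<mu> - \<omega>)) ^ n\<close> at
    \<open>\<mu> = n / t\<close>, written to fit the limit of
    \<open>(1 + a / n) ^ n\<close>.\<close>
  define q where "q n = inverse ((1 + (- (\<omega> * t)) / real n) ^ n)" for n
  have "(\<epsilon> \<longlongrightarrow> N (A x - A x)) (at_right 0)"
    unfolding \<epsilon>_def by (intro tendsto_N tendsto_diff generator_limit x T_right_continuous_0)
  then have "(\<epsilon> \<longlongrightarrow> 0) (at_right 0)"
    by (simp add: N_0)
  moreover have "filterlim (\<lambda>n. t / real n) (at_right 0) sequentially"
  proof (rule tendsto_imp_filterlim_at_right)
    show "(\<lambda>n. t / real n) \<longlonglongrightarrow> 0"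
      by (rule lim_const_over_n)
    show "\<forall>\<^sub>F n in sequentially. 0 < t / real n"
      using eventually_gt_at_top[of 0] by eventually_elim (use t in simp)
  qed
  ultimately have "(\<lambda>n. \<epsilon> (t / real n)) \<longlonglongrightarrow> 0"
    by (rule filterlim_compose)
  moreover have "q \<longlonglongrightarrow> inverse (exp (- (\<omega> * t)))"
    unfolding q_def by (intro tendsto_inverse tendsto_exp_limit_sequentially) simp
  ultimately have "(\<lambda>n. t * q n * \<epsilon> (t / real n)) \<longlonglongrightarrow> t * inverse (exp (- (\<omega> * t))) * 0"
    by (intro tendsto_intros)
  then show "(\<lambda>n. t * q n * \<epsilon> (t / real n)) \<longlonglongrightarrow> 0"
    by simp
  show "\<forall>\<^sub>F n in sequentially.
      norm ((euler (real n / t) ^^ n) x - T t x) \<le> t * q n * \<epsilon> (t / real n)"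
    using eventually_gt_at_top[of "nat \<lceil>\<omega> * t\<rceil>"]
  proof eventually_elim
    case (elim n)
    define \<mu> where "\<mu> = real n / t"
    have \<omega>n: "\<omega> * t < real n"
      using elim by linarith
    then have n: "0 < real n"
      using mult_pos_pos[OF \<omega>_pos t] by linarith
    have \<mu>: "\<omega> < \<mu>"
      using \<omega>n t by (simp add: \<mu>_def field_simps)
    have "(\<mu> / (\<mu> - \<omega>)) ^ n = q n"
      using t n \<omega>n by (simp add: q_def \<mu>_def field_simps flip: power_inverse)
    moreover have "real n / \<mu> = t" "1 / \<mu> = t / real n"
      using n t by (simp_all add: \<mu>_def)
    ultimately have "N (T t x - (euler \<mu> ^^ n) x) \<le> t * q n * \<epsilon> (t / real n)"
      using euler_global_error[OF \<mu> x, of n] by (simp add: \<epsilon>_def \<mu>_def)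
    then show ?case
      using norm_le_N[of "(euler \<mu> ^^ n) x - T t x"] N_minus_commute[of "T t x"]
      by (simp add: \<mu>_def)
  qed
qed

text \<open>On \<open>D\<close> the difference \<open>euler \<mu> d - d\<close> is the resolvent of
  \<open>A d\<close>, which is of order \<open>1 / \<mu>\<close>. For
  \<open>2 * \<omega> \<le> \<mu>\<close> the Euler steps are bounded by 2 with respect to
  \<open>N\<close>, and density of \<open>D\<close> extends the convergence to all
  \<open>x\<close>.\<close>

lemma euler_tendsto_identity: "((\<lambda>\<mu>. euler \<mu> x) \<longlongrightarrow> x) at_top"
proof (rule tendstoI)
  fix e :: real
  assume e: "0 < e"
  \<comment> \<open>The error splits into parts below \<open>2 * (e / 6)\<close>,
    \<open>e / 2\<close> and \<open>e / 6\<close>; \<open>M + 1\<close> instead of \<open>M\<close>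
    keeps the denominator positive.\<close>
  have "x \<in> closure D" "0 < e / (6 * (M + 1))"
    using e M_nonneg by (simp_all add: generator_domain_dense)
  then obtain d where d: "d \<in> D" "dist d x < e / (6 * (M + 1))"
    using closure_approachable by blast
  have "N (x - d) \<le> M * norm (x - d)"
    by (rule N_le_norm)
  also have "\<dots> \<le> (M + 1) * norm (x - d)"
    by (intro mult_right_mono) auto
  also have "\<dots> < (M + 1) * (e / (6 * (M + 1)))"
    using d(2) M_nonneg by (intro mult_strict_left_mono) (auto simp: dist_norm norm_minus_commute)
  also have "\<dots> = e / 6"
    using M_nonneg by (simp add: divide_simps)
  finally have xd: "N (x - d) < e / 6" .
  show "\<forall>\<^sub>F \<mu> in at_top. dist (euler \<mu> x) x < e"
    using eventually_ge_at_top[of "2 * \<omega>"] eventually_gt_at_top[of "\<omega> + 2 * N (A d) / e"]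
  proof eventually_elim
    case (elim \<mu>)
    have \<mu>: "\<omega> < \<mu>"
      using elim(1) \<omega>_pos by simp
    have "euler \<mu> d - d = resolvent D A \<mu> (\<mu> *\<^sub>R d) - resolvent D A \<mu> (\<mu> *\<^sub>R d - A d)"
      by (simp add: euler_def resolvent_scaleR[OF \<mu>] resolvent_left[OF \<mu> d(1)])
    also have "\<dots> = resolvent D A \<mu> (A d)"
      by (simp flip: resolvent_diff[OF \<mu>])
    finally have "N (euler \<mu> d - d) \<le> N (A d) / (\<mu> - \<omega>)"
      using N_resolvent[OF \<mu>] by simp
    also have "\<dots> < e / 2"
      using elim(2) \<mu> e by (simp add: field_simps)
    finally have 1: "N (euler \<mu> d - d) < e / 2" .
    have "N (euler \<mu> (x - d)) \<le> \<mu> / (\<mu> - \<omega>) * N (x - d)"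
      by (rule N_euler[OF \<mu>])
    also have "\<dots> \<le> 2 * N (x - d)"
      using elim(1) \<mu> by (intro mult_right_mono N_nonneg) (simp add: field_simps)
    finally have 2: "N (euler \<mu> (x - d)) < e / 3"
      using xd by simp
    have "euler \<mu> x - x = euler \<mu> (x - d) + ((euler \<mu> d - d) + (d - x))"
      by (simp add: euler_diff[OF \<mu>])
    then have "N (euler \<mu> x - x) \<le> N (euler \<mu> (x - d)) + (N (euler \<mu> d - d) + N (d - x))"
      by (metis N_add add_left_mono order_trans)
    then show ?case
      using 1 2 xd norm_le_N[of "euler \<mu> x - x"] by (simp add: dist_norm N_minus_commute[of d])
  qed
qed

text \<open>
  The exponential formula applies to \<open>euler \<mu> x \<in> D\<close>, which stays in \<open>V\<close> and tends to \<open>x\<close>.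
\<close>

lemma invariant_closed_set:
  assumes V: "closed V"
    and invariant: "\<And>\<mu> x. \<mu>\<^sub>0 \<le> \<mu> \<Longrightarrow> \<omega> < \<mu> \<Longrightarrow> x \<in> V \<Longrightarrow> euler \<mu> x \<in> V"
    and t: "0 \<le> t" and x: "x \<in> V"
  shows "T t x \<in> V"
proof (cases "t = 0")
  case True
  then show ?thesis
    using x by (simp add: T_0)
next
  case False
  with t have t: "0 < t"
    by simp
  have domain: "T t y \<in> V" if y: "y \<in> D" "y \<in> V" for y
  proof (rule Lim_in_closed_set[OF V _ _ exponential_formula[OF y(1) t]])
    show "\<forall>\<^sub>F n in sequentially. (euler (real n / t) ^^ n) y \<in> V"
      using eventually_gt_at_top[of "nat \<lceil>\<mu>\<^sub>0 * t\<rceil>"] eventually_gt_at_top[of "nat \<lceil>\<omega> * t\<rceil>"]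
    proof eventually_elim
      case (elim n)
      then have "\<mu>\<^sub>0 * t < real n" "\<omega> * t < real n"
        by linarith+
      then have "\<mu>\<^sub>0 < real n / t" "\<omega> < real n / t"
        using t by (simp_all add: pos_less_divide_eq)
      \<comment> \<open>The number of steps \<open>k\<close> is decoupled from \<open>n\<close>, so
        that the induction keeps the step length fixed.\<close>
      then have "(euler (real n / t) ^^ k) y \<in> V" for k
        by (induction k) (use y(2) invariant in auto)
      then show ?case .
    qed
  qed simp
  show ?thesis
  proof (rule Lim_in_closed_set[OF V])
    show "((\<lambda>\<mu>. T t (euler \<mu> x)) \<longlongrightarrow> T t x) at_top"
      by (intro tendsto_intros euler_tendsto_identity)
    show "\<forall>\<^sub>F \<mu> in at_top. T t (euler \<mu> x) \<in> V"
      using eventually_ge_at_top[of \<mu>\<^sub>0] eventually_gt_at_top[of \<omega>]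
    proof eventually_elim
      case (elim \<mu>)
      have "euler \<mu> x \<in> D"
        using generator_linear(1)[OF resolvent_in_domain[OF elim(2)] resolvent_in_domain[OF elim(2)], of \<mu> x 0 x]
        by (simp add: euler_def)
      then show ?case
        using elim x by (intro domain invariant)
    qed
  qed simp
qed

end

section \<open>Renorming and conclusion\<close>

text \<open>The new norm is an exponentially weighted supremum over the orbit. Time 0 gives
  \<open>norm x \<le> N x\<close>; replacing \<open>x\<close> by \<open>T t x\<close> restricts the
  supremum to times from \<open>t\<close> on, at the cost of the factor
  \<open>exp (\<omega> * t)\<close>.\<close>

lemma (in strongly_continuous_semigroup) quasi_contraction_renorming:
  obtains N M \<omega> where "quasi_contraction_semigroup T N M \<omega>"
proof -
  obtain M \<omega> where M: "0 < M" "0 < \<omega>" "\<And>t. 0 \<le> t \<Longrightarrow> norm (T t) \<le> M * exp (\<omega> * t)"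
    using exponential_bound by blast
  define g where "g x t = exp (- \<omega> * t) * norm (T t x)" for x t
  define N where "N x = (SUP t\<in>{0..}. g x t)" for x
  have g_bound: "g x t \<le> M * norm x" if "0 \<le> t" for x t
  proof -
    have "norm (T t x) \<le> norm (T t) * norm x"
      by (rule norm_blinfun)
    also have "\<dots> \<le> (M * exp (\<omega> * t)) * norm x"
      by (intro mult_right_mono M(3) that) simp
    finally have "g x t \<le> exp (- \<omega> * t) * ((M * exp (\<omega> * t)) * norm x)"
      unfolding g_def by (intro mult_left_mono) auto
    also have "\<dots> = M * norm x"
      by (simp add: exp_minus)
    finally show ?thesis .
  qed
  have g_le_N: "g x t \<le> N x" if "0 \<le> t" for x t
    unfolding N_def using that g_bound by (intro cSUP_upper bdd_aboveI2) auto
  have N_leI: "N x \<le> c" if "\<And>t. 0 \<le> t \<Longrightarrow> g x t \<le> c" for x c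
    unfolding N_def using that by (intro cSUP_least) auto
  have scale_le: "N (a *\<^sub>R x) \<le> \<bar>a\<bar> * N x" for a x
  proof (rule N_leI)
    fix t :: real
    assume t: "0 \<le> t"
    have "g (a *\<^sub>R x) t = \<bar>a\<bar> * g x t"
      by (simp add: g_def blinfun.scaleR_right)
    also have "\<dots> \<le> \<bar>a\<bar> * N x"
      by (intro mult_left_mono g_le_N t) simp
    finally show "g (a *\<^sub>R x) t \<le> \<bar>a\<bar> * N x" .
  qed
  have "quasi_contraction_semigroup T N M \<omega>"
  proof
    show "norm x \<le> N x" for x
      using g_le_N[of 0 x] by (simp add: g_def T_0)
    show "N x \<le> M * norm x" for x
      by (intro N_leI g_bound)
    show "N (x + y) \<le> N x + N y" for x y
    proof (rule N_leI)
      fix t :: real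
      assume t: "0 \<le> t"
      have "g (x + y) t \<le> exp (- \<omega> * t) * (norm (T t x) + norm (T t y))"
        unfolding g_def by (intro mult_left_mono) (auto simp: blinfun.add_right norm_triangle_ineq)
      also have "\<dots> = g x t + g y t"
        by (simp add: g_def distrib_left)
      also have "\<dots> \<le> N x + N y"
        by (intro add_mono g_le_N t)
      finally show "g (x + y) t \<le> N x + N y" .
    qed
    show "N (a *\<^sub>R x) = \<bar>a\<bar> * N x" for a x
    proof (cases "a = 0")
      case True
      have "N 0 = 0"
        using N_leI[of 0 0] g_le_N[of 0 0] by (simp add: g_def blinfun.zero_right)
      with True show ?thesis
        by simp
    next
      case False
      \<comment> \<open>The reverse inequality is \<open>scale_le\<close> for
        \<open>inverse a\<close> at the point \<open>a x\<close>.\<close>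
      have "\<bar>a\<bar> * N x = \<bar>a\<bar> * N (inverse a *\<^sub>R a *\<^sub>R x)"
        using False by simp
      also have "\<dots> \<le> \<bar>a\<bar> * (\<bar>inverse a\<bar> * N (a *\<^sub>R x))"
        by (intro mult_left_mono scale_le) simp
      also have "\<dots> = N (a *\<^sub>R x)"
        using False by simp
      finally show ?thesis
        using scale_le[of a x] by simp
    qed
    show "N (T t x) \<le> exp (\<omega> * t) * N x" if t: "0 \<le> t" for t x
    proof (rule N_leI)
      fix s :: real
      assume s: "0 \<le> s"
      have "g (T t x) s = exp (\<omega> * t) * g x (s + t)"
        by (simp add: g_def T_add[OF s t] algebra_simps flip: exp_add)
      also have "\<dots> \<le> exp (\<omega> * t) * N x"
        using s t by (intro mult_left_mono g_le_N) auto
      finally show "g (T t x) s \<le> exp (\<omega> * t) * N x" .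
    qed
  qed (use M in auto)
  then show thesis
    by (rule that)
qed

theorem theorem5p5:
  fixes K :: "'a::banach set"
    and T :: "real \<Rightarrow> ('a \<Rightarrow>\<^sub>L 'a)"
  assumes "ordered_banach_space K"
    and "semimonotone_norm K"
    and "C0_semigroup T"
    and "local_operator K (generator_domain T) (generator T)"
    and "\<exists>\<mu>\<^sub>0 \<in> real_resolvent_set (generator_domain T) (generator T).
           \<forall>\<mu> \<in> real_resolvent_set (generator_domain T) (generator T). \<mu>\<^sub>0 \<le> \<mu> \<longrightarrow>
             local_operator K UNIV (resolvent (generator_domain T) (generator T) \<mu>)"
  shows "\<forall>t\<ge>0. local_operator K UNIV (blinfun_apply (T t))"
proof -
  interpret banach_cone K
    by unfold_locales (fact assms(1))
  interpret strongly_continuous_semigroup T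
    by unfold_locales (fact assms(3))
  obtain N M \<omega> where "quasi_contraction_semigroup T N M \<omega>"
    by (rule quasi_contraction_renorming)
  then interpret quasi_contraction_semigroup T N M \<omega> .
  obtain \<mu>\<^sub>0 where resolvent_local: "\<And>\<mu>. \<mu> \<in> real_resolvent_set D A \<Longrightarrow> \<mu>\<^sub>0 \<le> \<mu> \<Longrightarrow>
      local_operator K UNIV (resolvent D A \<mu>)"
    using assms(5) by blast
  have "disjoint_elems K (T t x) y" if t: "0 \<le> t" and disj: "disjoint_elems K x y" for t x y
  proof -
    have "T t x \<in> {x. disjoint_elems K x y}"
    proof (rule invariant_closed_set[OF closed_disjoint_complement _ t])
      fix \<mu> z
      assume \<mu>: "\<mu>\<^sub>0 \<le> \<mu>" "\<omega> < \<mu>" and z: "z \<in> {x. disjoint_elems K x y}"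
      then have "disjoint_elems K (resolvent D A \<mu> z) y"
        using resolvent_local[OF real_resolvent_setI] by (simp add: local_operator_def)
      \<comment> \<open>Since \<omega> is positive, so is \<mu>, and the scaling property covers the
        factor in \<open>euler\<close>.\<close>
      then show "euler \<mu> z \<in> {x. disjoint_elems K x y}"
        using \<mu>(2) \<omega>_pos by (simp add: euler_def disjoint_elems_scaleR)
    qed (use disj in simp)
    then show ?thesis
      by simp
  qed
  then show ?thesis
    by (simp add: local_operator_def)
qed

end
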